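(* Let $\phi(x)=b_0+b_1x+\cdots+b_nx^n$ be a complex polynomial of degree $n\ge 2$ with exactly $\ell$ non-zero coefficients, and let $$k=\begin{cases}\ell+2 & \text{if } \phi(0)=\phi'(0)=0,\\ \ell+1 & \text{if exactly one of } \phi(0),\phi'(0) \text{ is zero},\\ \ell & \text{if } \phi(0)\neq 0 \text{ and } \phi'(0)\neq 0.\end{cases}$$ Let $I_\phi=\{i\in\{2,\dots,n\}: b_i\neq 0\}=\{j_1<j_2<\cdots<j_{k-2}\}$. Then $$\mathfrak{g}_\phi\cong\mathbb{C}^2\oplus\mathfrak{h}$$ (with $\mathbb{C}^2$ abelian), where $\mathfrak{h}$ is a solvable Lie algebra of dimension $k$ with an abelian nilradical of dimension $k-1$. More precisely, $$\mathfrak{h}\cong\langle E\rangle\ltimes\langle E_1,\dots,E_{k-1}\rangle,$$ where $\langle E_1,\dots,E_{k-1}\rangle$ is abelian and the remaining brackets are $$[E,E_1]=E_1,\qquad [E,E_t]=j_{t-1}E_t\quad\text{for } t=2,\dots,k-1.$$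
   Context: Fix $N\in\mathbb{N}$, a real number $\nu>0$ and real numbers $a_1,\dots,a_{N-1}$. Let $E_{i,j}$ be the $N\times N$ matrix units and $$J=\sum_{k=1}^N kE_{k,k},\qquad A=\sum_{k=1}^{N-1}a_kE_{k+1,k}.$$ Differential operators $\mathcal{E}=\sum_j \partial_x^jF_j(x)$ with matrix valued coefficients act from the right on $N\times N$ matrix valued functions by $P\cdot\mathcal{E}=\sum_j P^{(j)}(x)F_j(x)$; products are defined by $P\cdot(\mathcal{E}_1\mathcal{E}_2)=(P\cdot\mathcal{E}_1)\cdot\mathcal{E}_2$ and $[\mathcal{E}_1,\mathcal{E}_2]=\mathcal{E}_1\mathcal{E}_2-\mathcal{E}_2\mathcal{E}_1$. Scalars denote multiples of the identity matrix, and scalar functions of $x$ act by multiplication. Put $$\mathcal{D}=\partial_x x+x(A-1),\qquad \mathcal{D}^\dagger=-\partial_x x-(1+\nu+J)+x\phi'(x)-x,$$ $$\mathfrak{g}_\phi=\operatorname{span}_{\mathbb{C}}\{1,\ \mathcal{D},\ \mathcal{D}^\dagger,\ x,\ x\phi'(x),\ x^2\phi^{(2)}(x),\ldots\},$$ which is a complex Lie algebra under the commutator bracket. The nilradical of a finite dimensional Lie algebra is its maximal nilpotent ideal.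
   Formalization: It is assumed that N ≥ 2: for N = 1 one has A = 0 and J = 1, so D + D† lies in the span of 1, x and xφ'(x), and the Lie algebra has dimension k+1 instead of k+2; for N = 0 all operators vanish. *)

theory Defs
  imports "HOL-Analysis.Analysis" "Jordan_Normal_Form.VS_Connect"
begin

section \<open>Complex Lie algebras\<close>

record 'a lie = "(complex, 'a) module" +
  lie_bracket :: "'a \<Rightarrow> 'a \<Rightarrow> 'a"

locale lie_algebra = vectorspace "class_ring :: complex ring" L
  for L :: "('a, 'm) lie_scheme" (structure) +
  assumes bracket_closed:
      "\<lbrakk>x \<in> carrier L; y \<in> carrier L\<rbrakk> \<Longrightarrow> lie_bracket L x y \<in> carrier L"
    and bracket_add_left:
      "\<lbrakk>x \<in> carrier L; y \<in> carrier L; z \<in> carrier L\<rbrakk> \<Longrightarrow>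
        lie_bracket L (x \<oplus> y) z = lie_bracket L x z \<oplus> lie_bracket L y z"
    and bracket_add_right:
      "\<lbrakk>x \<in> carrier L; y \<in> carrier L; z \<in> carrier L\<rbrakk> \<Longrightarrow>
        lie_bracket L x (y \<oplus> z) = lie_bracket L x y \<oplus> lie_bracket L x z"
    and bracket_smult_left:
      "\<lbrakk>x \<in> carrier L; y \<in> carrier L\<rbrakk> \<Longrightarrow>
        lie_bracket L (c \<odot> x) y = c \<odot> lie_bracket L x y"
    and bracket_smult_right:
      "\<lbrakk>x \<in> carrier L; y \<in> carrier L\<rbrakk> \<Longrightarrow>
        lie_bracket L x (c \<odot> y) = c \<odot> lie_bracket L x y"
    and bracket_self: "x \<in> carrier L \<Longrightarrow> lie_bracket L x x = \<zero>"
    and jacobi: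
      "\<lbrakk>x \<in> carrier L; y \<in> carrier L; z \<in> carrier L\<rbrakk> \<Longrightarrow>
        lie_bracket L x (lie_bracket L y z) \<oplus> lie_bracket L y (lie_bracket L z x)
          \<oplus> lie_bracket L z (lie_bracket L x y) = \<zero>"

definition lie_isomorphic ::
  "('a, 'm) lie_scheme \<Rightarrow> ('b, 'n) lie_scheme \<Rightarrow> bool" where
  "lie_isomorphic L M \<longleftrightarrow> lie_algebra L \<and> lie_algebra M \<and>
     (\<exists>f \<in> module_hom (class_ring :: complex ring) L M.
        bij_betw f (carrier L) (carrier M) \<and>
        (\<forall>x \<in> carrier L. \<forall>y \<in> carrier L.
           f (lie_bracket L x y) = lie_bracket M (f x) (f y)))"

definition lie_has_dim :: "('a, 'm) lie_scheme \<Rightarrow> nat \<Rightarrow> bool" where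
  "lie_has_dim L d \<longleftrightarrow>
     vectorspace.fin_dim (class_ring :: complex ring) L \<and>
     vectorspace.dim (class_ring :: complex ring) L = d"

definition lie_span :: "('a, 'm) lie_scheme \<Rightarrow> 'a set \<Rightarrow> 'a set" where
  "lie_span L S = LinearCombinations.module.span (class_ring :: complex ring) L S"

definition lie_abelian :: "('a, 'm) lie_scheme \<Rightarrow> bool" where
  "lie_abelian L \<longleftrightarrow> (\<forall>x \<in> carrier L. \<forall>y \<in> carrier L. lie_bracket L x y = \<zero>\<^bsub>L\<^esub>)"

definition bracket_space :: "('a, 'm) lie_scheme \<Rightarrow> 'a set \<Rightarrow> 'a set \<Rightarrow> 'a set" where
  "bracket_space L A B = lie_span L {lie_bracket L x y | x y. x \<in> A \<and> y \<in> B}"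

primrec derived_series :: "('a, 'm) lie_scheme \<Rightarrow> nat \<Rightarrow> 'a set" where
  "derived_series L 0 = carrier L"
| "derived_series L (Suc m) = bracket_space L (derived_series L m) (derived_series L m)"

primrec lower_central_series :: "('a, 'm) lie_scheme \<Rightarrow> nat \<Rightarrow> 'a set" where
  "lower_central_series L 0 = carrier L"
| "lower_central_series L (Suc m) = bracket_space L (carrier L) (lower_central_series L m)"

definition lie_solvable :: "('a, 'm) lie_scheme \<Rightarrow> bool" where
  "lie_solvable L \<longleftrightarrow> (\<exists>m. derived_series L m = {\<zero>\<^bsub>L\<^esub>})"

definition lie_nilpotent :: "('a, 'm) lie_scheme \<Rightarrow> bool" where
  "lie_nilpotent L \<longleftrightarrow> (\<exists>m. lower_central_series L m = {\<zero>\<^bsub>L\<^esub>})"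

definition lie_subalgebra :: "'a set \<Rightarrow> ('a, 'm) lie_scheme \<Rightarrow> bool" where
  "lie_subalgebra S L \<longleftrightarrow> VectorSpace.subspace (class_ring :: complex ring) S L \<and>
     (\<forall>x \<in> S. \<forall>y \<in> S. lie_bracket L x y \<in> S)"

definition lie_ideal :: "'a set \<Rightarrow> ('a, 'm) lie_scheme \<Rightarrow> bool" where
  "lie_ideal I L \<longleftrightarrow> VectorSpace.subspace (class_ring :: complex ring) I L \<and>
     (\<forall>x \<in> carrier L. \<forall>y \<in> I. lie_bracket L x y \<in> I)"

definition is_nilradical :: "'a set \<Rightarrow> ('a, 'm) lie_scheme \<Rightarrow> bool" where
  "is_nilradical R L \<longleftrightarrow> lie_ideal R L \<and> lie_nilpotent (L\<lparr>carrier := R\<rparr>) \<and>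
     (\<forall>I. lie_ideal I L \<and> lie_nilpotent (L\<lparr>carrier := I\<rparr>) \<longrightarrow> I \<subseteq> R)"

text \<open>\<open>L\<close> is the (internal) semidirect product of the subalgebra \<open>S\<close> with the ideal \<open>I\<close>.\<close>

definition lie_semidirect :: "('a, 'm) lie_scheme \<Rightarrow> 'a set \<Rightarrow> 'a set \<Rightarrow> bool" where
  "lie_semidirect L S I \<longleftrightarrow> lie_subalgebra S L \<and> lie_ideal I L \<and>
     S \<inter> I = {\<zero>\<^bsub>L\<^esub>} \<and> {s \<oplus>\<^bsub>L\<^esub> i | s i. s \<in> S \<and> i \<in> I} = carrier L"

definition abelian_lie :: "nat \<Rightarrow> complex vec lie" where
  "abelian_lie m = \<lparr>carrier = carrier_vec m, mult = undefined, one = undefined,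
     zero = 0\<^sub>v m, add = (+), smult = (\<cdot>\<^sub>v), lie_bracket = (\<lambda>v w. 0\<^sub>v m)\<rparr>"

definition lie_direct_sum ::
  "('a, 'm) lie_scheme \<Rightarrow> ('b, 'n) lie_scheme \<Rightarrow> ('a \<times> 'b) lie" where
  "lie_direct_sum L M = \<lparr>carrier = carrier L \<times> carrier M, mult = undefined, one = undefined,
     zero = (\<zero>\<^bsub>L\<^esub>, \<zero>\<^bsub>M\<^esub>),
     add = (\<lambda>v w. (fst v \<oplus>\<^bsub>L\<^esub> fst w, snd v \<oplus>\<^bsub>M\<^esub> snd w)),
     smult = (\<lambda>c v. (c \<odot>\<^bsub>L\<^esub> fst v, c \<odot>\<^bsub>M\<^esub> snd v)),
     lie_bracket = (\<lambda>v w. (lie_bracket L (fst v) (fst w), lie_bracket M (snd v) (snd w)))\<rparr>"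


section \<open>Matrix valued differential operators acting from the right\<close>

definition smooth :: "(real \<Rightarrow> complex) \<Rightarrow> bool" where
  "smooth f \<longleftrightarrow>
     (\<forall>m x. ((\<lambda>g t. vector_derivative g (at t)) ^^ m) f differentiable (at x))"

definition smooth_mfuns :: "nat \<Rightarrow> (real \<Rightarrow> complex mat) set" where
  "smooth_mfuns N = {P. (\<forall>x. P x \<in> carrier_mat N N) \<and>
     (\<forall>r < N. \<forall>c < N. smooth (\<lambda>x. P x $$ (r, c)))}"

definition mderiv :: "nat \<Rightarrow> (real \<Rightarrow> complex mat) \<Rightarrow> (real \<Rightarrow> complex mat)" where
  "mderiv N P = (\<lambda>x. mat N N (\<lambda>(r, c). vector_derivative (\<lambda>t. P t $$ (r, c)) (at x)))"

text \<open>An operator is identified with its right action on smooth \<open>N \<times> N\<close> matrix valued functions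
  of a real variable, and is \<^const>\<open>undefined\<close> elsewhere so that two operators are equal
  iff their actions agree.  The list \<open>Fs\<close> holds the coefficients \<open>F\<^sub>0, F\<^sub>1, \<dots>\<close> of
  \<open>\<Sum>\<^sub>j \<partial>\<^sub>x\<^sup>j F\<^sub>j(x)\<close>.\<close>

type_synonym operator = "(real \<Rightarrow> complex mat) \<Rightarrow> (real \<Rightarrow> complex mat)"

definition diffop :: "nat \<Rightarrow> (real \<Rightarrow> complex mat) list \<Rightarrow> operator" where
  "diffop N Fs = (\<lambda>P \<in> smooth_mfuns N. \<lambda>x. mat N N (\<lambda>(r, c).
     \<Sum>j < length Fs. ((mderiv N ^^ j) P x * (Fs ! j) x) $$ (r, c)))"

text \<open>Right action: in the product \<open>E\<^sub>1 E\<^sub>2\<close> the operator \<open>E\<^sub>1\<close> is applied first.\<close>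

definition op_mult :: "nat \<Rightarrow> operator \<Rightarrow> operator \<Rightarrow> operator" where
  "op_mult N E1 E2 = (\<lambda>P \<in> smooth_mfuns N. E2 (E1 P))"

definition diffop_lie :: "nat \<Rightarrow> operator lie" where
  "diffop_lie N = \<lparr>carrier = {diffop N Fs | Fs. set Fs \<subseteq> smooth_mfuns N},
     mult = op_mult N,
     one = (\<lambda>P \<in> smooth_mfuns N. P),
     zero = (\<lambda>P \<in> smooth_mfuns N. \<lambda>x. 0\<^sub>m N N),
     add = (\<lambda>E1 E2. \<lambda>P \<in> smooth_mfuns N. \<lambda>x. E1 P x + E2 P x),
     smult = (\<lambda>c E. \<lambda>P \<in> smooth_mfuns N. \<lambda>x. c \<cdot>\<^sub>m E P x),
     lie_bracket = (\<lambda>E1 E2. \<lambda>P \<in> smooth_mfuns N. \<lambda>x.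
       op_mult N E1 E2 P x - op_mult N E2 E1 P x)\<rparr>"


section \<open>The Lie algebra attached to a polynomial\<close>

text \<open>Matrix indices start at \<open>0\<close>, so the matrix unit \<open>E\<^sub>i\<^sub>,\<^sub>j\<close> sits at position
  \<open>(i - 1, j - 1)\<close>.\<close>

definition J_mat :: "nat \<Rightarrow> complex mat" where
  "J_mat N = mat N N (\<lambda>(r, c). if r = c then of_nat (r + 1) else 0)"

definition A_mat :: "nat \<Rightarrow> (nat \<Rightarrow> real) \<Rightarrow> complex mat" where
  "A_mat N a = mat N N (\<lambda>(r, c). if r = c + 1 then complex_of_real (a (c + 1)) else 0)"

definition scalar_mfun :: "nat \<Rightarrow> (real \<Rightarrow> complex) \<Rightarrow> (real \<Rightarrow> complex mat)" where
  "scalar_mfun N f = (\<lambda>x. f x \<cdot>\<^sub>m 1\<^sub>m N)"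

definition scalar_op :: "nat \<Rightarrow> (real \<Rightarrow> complex) \<Rightarrow> operator" where
  "scalar_op N f = diffop N [scalar_mfun N f]"

text \<open>The function \<open>x\<^sup>i \<phi>\<^sup>(\<^sup>i\<^sup>)(x)\<close>.\<close>

definition xphi :: "complex poly \<Rightarrow> nat \<Rightarrow> real \<Rightarrow> complex" where
  "xphi \<phi> i x = complex_of_real x ^ i * poly ((pderiv ^^ i) \<phi>) (complex_of_real x)"

definition D_op :: "nat \<Rightarrow> (nat \<Rightarrow> real) \<Rightarrow> operator" where
  "D_op N a = diffop N
     [\<lambda>x. complex_of_real x \<cdot>\<^sub>m (A_mat N a - 1\<^sub>m N),
      scalar_mfun N complex_of_real]"

definition Ddag_op :: "nat \<Rightarrow> real \<Rightarrow> complex poly \<Rightarrow> operator" where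
  "Ddag_op N \<nu> \<phi> = diffop N
     [\<lambda>x. - (complex_of_real (1 + \<nu>) \<cdot>\<^sub>m 1\<^sub>m N + J_mat N)
           + (xphi \<phi> 1 x - complex_of_real x) \<cdot>\<^sub>m 1\<^sub>m N,
      scalar_mfun N (\<lambda>x. - complex_of_real x)]"

text \<open>For \<open>N = 1\<close> one has \<open>A = 0\<close> and \<open>J = 1\<close>, so the sum of \<open>D_op\<close> and \<open>Ddag_op\<close> already lies in
  the span of \<open>1\<close>, \<open>x\<close> and \<open>x \<phi>'(x)\<close>, and the dimension of \<open>g_phi\<close> drops by one; its structure is
  therefore only described for \<open>N \<ge> 2\<close>.\<close>

definition g_phi :: "nat \<Rightarrow> real \<Rightarrow> (nat \<Rightarrow> real) \<Rightarrow> complex poly \<Rightarrow> operator lie" where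
  "g_phi N \<nu> a \<phi> = (diffop_lie N)\<lparr>carrier := lie_span (diffop_lie N)
     ({scalar_op N (\<lambda>x. 1), D_op N a, Ddag_op N \<nu> \<phi>, scalar_op N complex_of_real}
       \<union> {scalar_op N (xphi \<phi> i) | i. i \<ge> 1})\<rparr>"

end

theory Submission
  imports Defs
begin

text \<open>All operators involved have one shape. For complex numbers \<open>c\<close>, \<open>\<alpha>\<close> and a polynomial \<open>p\<close>
let \<open>(c, \<alpha>, p)\<close> stand for the operator \<open>P \<mapsto> P M + \<alpha> x P'\<close> with
\<open>M(x) = (c + \<alpha>) x A - c J + p(x)\<close>; this is \<open>normal_op\<close> below. It depends linearly on the
triple, and
\<^item> \<open>\<D> = (0, 1, -x)\<close>,
\<^item> \<open>\<D>\<dagger> = (1, -1, x \<phi>' - x - (1 + \<nu>))\<close>,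
\<^item> multiplication by \<open>f\<close> is \<open>(0, 0, f)\<close>.

Because of \<open>[J, A] = A\<close> the matrix parts of a commutator cancel, which leaves
\<open>[(c, \<alpha>, p), (d, \<beta>, q)] = (0, 0, x (\<beta> p' - \<alpha> q'))\<close> (lemma \<open>bracket_normal_op\<close>). So
\<open>(1, 0, 0) = x A - J\<close> and \<open>(0, 0, 1)\<close> are central, the operators \<open>(0, 0, p)\<close> commute, and
\<open>(0, -1, 0)\<close> acts on them as the Euler operator \<open>p \<mapsto> x p'\<close>, with \<open>x\<^sup>j\<close> as an eigenvector for
the eigenvalue \<open>j\<close>. This is the asserted structure; that the sum is direct and the
dimension is as claimed means that a triple is determined by its operator
(\<open>normal_op_inject\<close>), and this uses \<open>N \<ge> 2\<close>: two diagonal entries of \<open>M\<close> are needed to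
separate \<open>c\<close> from the constant term of \<open>p\<close>.

It remains to see which polynomials \<open>p\<close> occur. The coefficient of \<open>x\<^sup>j\<close> in \<open>x\<^sup>i \<phi>\<^sup>(\<^sup>i\<^sup>)\<close> is
\<open>j (j - 1) \<cdots> (j - i + 1) b\<^sub>j\<close>, a falling factorial in \<open>j\<close> times \<open>b\<^sub>j\<close>. Polynomials in \<open>j\<close>
divisible by \<open>j\<close> are combinations of these falling factorials, so interpolation isolates
each \<open>x\<^sup>j\<close> with \<open>j \<ge> 1\<close> and \<open>b\<^sub>j \<noteq> 0\<close> (\<open>monom_in_xphi_poly_span\<close>). With the generators \<open>1\<close>
and \<open>x\<close> one gets exactly the \<open>p\<close> supported on \<open>{0, 1} \<union> I\<^sub>\<phi>\<close> (\<open>g_phi_carrier\<close>).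

The algebra \<open>\<hh>\<close> is realised on \<open>\<complex>\<^sup>k\<close>: the coordinate \<open>0\<close> belongs to \<open>E\<close> and the coordinate \<open>t\<close>
to an eigenvector \<open>E\<^sub>t\<close>. An ideal that contains a vector with nonzero coordinate \<open>0\<close> contains
some \<open>E\<^sub>t\<close> together with a vector acting on \<open>E\<^sub>t\<close> as the identity, so it is not nilpotent; hence
the nilradical is the hyperplane where that coordinate vanishes.\<close>

unbundle no vec_syntax

section \<open>Smooth functions\<close>

text \<open>A class of functions that are differentiable and whose derivatives lie in the class again
consists of smooth functions; this replaces inductions over iterated derivatives.\<close>

lemma smooth_coinduct:
  assumes "X f"
    and diff: "\<And>f x. X f \<Longrightarrow> f differentiable (at x)"
    and step: "\<And>f. X f \<Longrightarrow> X (\<lambda>t. vector_derivative f (at t))"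
  shows "smooth f"
proof -
  have "X (((\<lambda>g t. vector_derivative g (at t)) ^^ m) f)" for m
    by (induction m) (auto simp: assms(1) step)
  then show ?thesis
    unfolding smooth_def using diff by blast
qed

lemma smooth_differentiable: "smooth f \<Longrightarrow> f differentiable (at x)"
  unfolding smooth_def by (metis funpow_0)

lemma smooth_vector_derivative:
  assumes "smooth f"
  shows "smooth (\<lambda>t. vector_derivative f (at t))"
  unfolding smooth_def
proof (intro allI)
  fix m x
  have "((\<lambda>g t. vector_derivative g (at t)) ^^ Suc m) f differentiable (at x)"
    using assms unfolding smooth_def by blast
  then show "((\<lambda>g t. vector_derivative g (at t)) ^^ m) (\<lambda>t. vector_derivative f (at t))
      differentiable (at x)"
    by (simp only: funpow_Suc_right o_def)
qed

text \<open>The ring generated by the smooth functions. By the sum and product rules it is closed under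
differentiation, so its members are smooth by coinduction. Closure of smooth functions under
sums and products follows at once. Products of two smooth functions would not suffice as the
class, since the derivative of such a product is a sum.\<close>

inductive smooth_ring :: "(real \<Rightarrow> complex) \<Rightarrow> bool" where
  base: "smooth f \<Longrightarrow> smooth_ring f"
| add: "smooth_ring f \<Longrightarrow> smooth_ring g \<Longrightarrow> smooth_ring (\<lambda>x. f x + g x)"
| mult: "smooth_ring f \<Longrightarrow> smooth_ring g \<Longrightarrow> smooth_ring (\<lambda>x. f x * g x)"

lemma smooth_ring_derivative:
  "smooth_ring f \<Longrightarrow>
    (\<forall>x. f differentiable (at x)) \<and> smooth_ring (\<lambda>t. vector_derivative f (at t))"
proof (induction rule: smooth_ring.induct)
  case (base f)
  then show ?case
    by (simp add: smooth_differentiable smooth_vector_derivative smooth_ring.base)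
next
  case (add f g)
  then have "(\<lambda>t. vector_derivative (\<lambda>x. f x + g x) (at t))
      = (\<lambda>t. vector_derivative f (at t) + vector_derivative g (at t))"
    by (intro ext vector_derivative_add_at) auto
  with add show ?case
    by (auto intro: smooth_ring.intros)
next
  case (mult f g)
  then have "(\<lambda>t. vector_derivative (\<lambda>x. f x * g x) (at t))
      = (\<lambda>t. f t * vector_derivative g (at t) + vector_derivative f (at t) * g t)"
    by (intro ext vector_derivative_mult_at) auto
  moreover have "smooth_ring \<dots>"
    by (intro smooth_ring.add smooth_ring.mult) (use mult in blast)+
  ultimately show ?case
    using mult by auto
qed

lemma smooth_ring_imp_smooth: "smooth_ring f \<Longrightarrow> smooth f"
  by (rule smooth_coinduct[of smooth_ring]) (auto dest: smooth_ring_derivative)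

lemma smooth_add: "smooth f \<Longrightarrow> smooth g \<Longrightarrow> smooth (\<lambda>x. f x + g x)"
  by (rule smooth_ring_imp_smooth[OF smooth_ring.add[OF smooth_ring.base smooth_ring.base]])

lemma smooth_mult: "smooth f \<Longrightarrow> smooth g \<Longrightarrow> smooth (\<lambda>x. f x * g x)"
  by (rule smooth_ring_imp_smooth[OF smooth_ring.mult[OF smooth_ring.base smooth_ring.base]])

lemma smooth_const: "smooth (\<lambda>x. c)"
  by (rule smooth_coinduct[of "\<lambda>f. \<exists>c. f = (\<lambda>x. c)"]) auto

lemma has_vector_derivative_complex_of_real:
  "(complex_of_real has_vector_derivative 1) (at x)"
  by (rule has_vector_derivative_real_field[where f = "\<lambda>x. x", OF DERIV_ident])

lemmas vector_derivative_of_real = vector_derivative_at[OF has_vector_derivative_complex_of_real]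
lemmas differentiable_of_real = differentiableI_vector[OF has_vector_derivative_complex_of_real]

lemma smooth_of_real: "smooth complex_of_real"
  by (rule smooth_coinduct[of "\<lambda>f. f = complex_of_real \<or> (\<exists>c. f = (\<lambda>x. c))"])
     (auto simp: vector_derivative_of_real differentiable_of_real)

lemma smooth_sum:
  assumes "\<And>i. i \<in> I \<Longrightarrow> smooth (f i)"
  shows "smooth (\<lambda>x. \<Sum>i\<in>I. f i x)"
  using assms by (induction I rule: infinite_finite_induct) (auto simp: smooth_const smooth_add)

lemma smooth_poly: "smooth (\<lambda>x. poly p (complex_of_real x))"
proof (induction p)
  case 0
  show ?case by (simp add: smooth_const)
next
  case (pCons a p)
  then show ?case
    using smooth_add[OF smooth_const smooth_mult[OF smooth_of_real], of "\<lambda>x. poly p (complex_of_real x)" a]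
    by simp
qed

lemma vector_derivative_poly:
  "vector_derivative (\<lambda>x. poly p (complex_of_real x)) (at x) = poly (pderiv p) (complex_of_real x)"
  by (rule vector_derivative_at[OF has_vector_derivative_real_field[OF poly_DERIV]])


section \<open>Smooth matrix valued functions\<close>

lemma smooth_mfunsI:
  "\<lbrakk>\<And>x. P x \<in> carrier_mat N N; \<And>r c. r < N \<Longrightarrow> c < N \<Longrightarrow> smooth (\<lambda>x. P x $$ (r, c))\<rbrakk>
    \<Longrightarrow> P \<in> smooth_mfuns N"
  by (auto simp: smooth_mfuns_def)

lemma smooth_mfuns_carrier: "P \<in> smooth_mfuns N \<Longrightarrow> P x \<in> carrier_mat N N"
  by (auto simp: smooth_mfuns_def)

lemma smooth_mfuns_dim:
  "P \<in> smooth_mfuns N \<Longrightarrow> dim_row (P x) = N"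
  "P \<in> smooth_mfuns N \<Longrightarrow> dim_col (P x) = N"
  using smooth_mfuns_carrier[of P N x] by auto

lemmas smooth_mfunsD = smooth_mfuns_carrier smooth_mfuns_dim

lemma smooth_mfuns_entry:
  "P \<in> smooth_mfuns N \<Longrightarrow> r < N \<Longrightarrow> c < N \<Longrightarrow> smooth (\<lambda>x. P x $$ (r, c))"
  by (auto simp: smooth_mfuns_def)

lemma mderiv_dim [simp]: "dim_row (mderiv N P x) = N" "dim_col (mderiv N P x) = N"
  "mderiv N P x \<in> carrier_mat N N"
  by (simp_all add: mderiv_def)

lemma mderiv_index [simp]:
  "r < N \<Longrightarrow> c < N \<Longrightarrow>
    mderiv N P x $$ (r, c) = vector_derivative (\<lambda>t. P t $$ (r, c)) (at x)"
  by (simp add: mderiv_def)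

lemma smooth_mfuns_mderiv: "P \<in> smooth_mfuns N \<Longrightarrow> mderiv N P \<in> smooth_mfuns N"
  by (rule smooth_mfunsI) (simp_all add: smooth_vector_derivative[OF smooth_mfuns_entry])

lemma smooth_mfuns_add:
  assumes "P \<in> smooth_mfuns N" "Q \<in> smooth_mfuns N"
  shows "(\<lambda>x. P x + Q x) \<in> smooth_mfuns N"
  using assms[THEN smooth_mfuns_dim(1)] assms[THEN smooth_mfuns_dim(2)]
    assms[THEN smooth_mfuns_carrier] assms[THEN smooth_mfuns_entry]
  by (intro smooth_mfunsI) (simp_all add: smooth_add)

lemma smooth_mfuns_smult:
  assumes "P \<in> smooth_mfuns N" "smooth f"
  shows "(\<lambda>x. f x \<cdot>\<^sub>m P x) \<in> smooth_mfuns N"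
  using assms(2) smooth_mfunsD[OF assms(1)] smooth_mfuns_entry[OF assms(1)]
  by (intro smooth_mfunsI) (simp_all add: smooth_mult)

lemma mult_mat_index:
  "\<lbrakk>A \<in> carrier_mat N N; B \<in> carrier_mat N N; r < N; c < N\<rbrakk> \<Longrightarrow>
    (A * B) $$ (r, c) = (\<Sum>i<N. A $$ (r, i) * B $$ (i, c))"
  by (auto simp: scalar_prod_def atLeast0LessThan)

lemma smooth_mfuns_mult:
  assumes "P \<in> smooth_mfuns N" "Q \<in> smooth_mfuns N"
  shows "(\<lambda>x. P x * Q x) \<in> smooth_mfuns N"
proof (rule smooth_mfunsI)
  note [simp] = smooth_mfunsD[OF assms(1)] smooth_mfunsD[OF assms(2)]
  show "P x * Q x \<in> carrier_mat N N" for x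
    by (rule mult_carrier_mat[of _ N N]) simp_all
  fix r c assume rc: "r < N" "c < N"
  then have "smooth (\<lambda>x. \<Sum>i<N. P x $$ (r, i) * Q x $$ (i, c))"
    using assms by (intro smooth_sum smooth_mult) (simp_all add: smooth_mfuns_entry)
  then show "smooth (\<lambda>x. (P x * Q x) $$ (r, c))"
    using rc by (simp add: mult_mat_index[of _ N] del: index_mult_mat(1))
qed

lemma smooth_mfuns_scalar: "smooth f \<Longrightarrow> scalar_mfun N f \<in> smooth_mfuns N"
  unfolding scalar_mfun_def
  by (rule smooth_mfuns_smult) (auto intro!: smooth_mfunsI smooth_const)

lemma smooth_mfuns_const: "A \<in> carrier_mat N N \<Longrightarrow> (\<lambda>x. A) \<in> smooth_mfuns N"
  by (auto intro!: smooth_mfunsI smooth_const)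

lemma mderiv_add:
  assumes "P \<in> smooth_mfuns N" "Q \<in> smooth_mfuns N"
  shows "mderiv N (\<lambda>x. P x + Q x) x = mderiv N P x + mderiv N Q x"
proof (rule eq_matI)
  note [simp] = smooth_mfunsD[OF assms(1)] smooth_mfunsD[OF assms(2)]
  fix r c assume rc: "r < dim_row (mderiv N P x + mderiv N Q x)"
    "c < dim_col (mderiv N P x + mderiv N Q x)"
  then have "r < N" "c < N" by simp_all
  then have "vector_derivative (\<lambda>t. P t $$ (r, c) + Q t $$ (r, c)) (at x)
     = vector_derivative (\<lambda>t. P t $$ (r, c)) (at x) + vector_derivative (\<lambda>t. Q t $$ (r, c)) (at x)"
    using assms by (intro vector_derivative_add_at smooth_differentiable smooth_mfuns_entry) auto
  then show "mderiv N (\<lambda>x. P x + Q x) x $$ (r, c) = (mderiv N P x + mderiv N Q x) $$ (r, c)"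
    using rc assms by simp
qed auto

lemma mderiv_smult:
  assumes "P \<in> smooth_mfuns N" "smooth f"
  shows "mderiv N (\<lambda>x. f x \<cdot>\<^sub>m P x) x
    = vector_derivative f (at x) \<cdot>\<^sub>m P x + f x \<cdot>\<^sub>m mderiv N P x"
proof (rule eq_matI)
  note [simp] = smooth_mfunsD[OF assms(1)]
  fix r c
  assume rc: "r < dim_row (vector_derivative f (at x) \<cdot>\<^sub>m P x + f x \<cdot>\<^sub>m mderiv N P x)"
    "c < dim_col (vector_derivative f (at x) \<cdot>\<^sub>m P x + f x \<cdot>\<^sub>m mderiv N P x)"
  then have "r < N" "c < N" by simp_all
  then have "vector_derivative (\<lambda>t. f t * P t $$ (r, c)) (at x)
     = f x * vector_derivative (\<lambda>t. P t $$ (r, c)) (at x) + vector_derivative f (at x) * P x $$ (r, c)"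
    using assms by (intro vector_derivative_mult_at smooth_differentiable smooth_mfuns_entry) auto
  then show "mderiv N (\<lambda>x. f x \<cdot>\<^sub>m P x) x $$ (r, c)
     = (vector_derivative f (at x) \<cdot>\<^sub>m P x + f x \<cdot>\<^sub>m mderiv N P x) $$ (r, c)"
    using rc assms by simp
qed (use smooth_mfunsD[OF assms(1)] in auto)

lemma mderiv_mult:
  assumes P: "P \<in> smooth_mfuns N" and Q: "Q \<in> smooth_mfuns N"
  shows "mderiv N (\<lambda>x. P x * Q x) x = mderiv N P x * Q x + P x * mderiv N Q x"
proof (rule eq_matI)
  note [simp] = smooth_mfunsD[OF assms(1)] smooth_mfunsD[OF assms(2)]
  fix r c
  assume "r < dim_row (mderiv N P x * Q x + P x * mderiv N Q x)"
    "c < dim_col (mderiv N P x * Q x + P x * mderiv N Q x)"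
  then have rc: "r < N" "c < N" using assms by auto
  have entry: "((\<lambda>t. P t $$ (i, j)) has_vector_derivative mderiv N P x $$ (i, j)) (at x)"
    if "P \<in> smooth_mfuns N" "i < N" "j < N" for P i j
    using that smooth_differentiable[OF smooth_mfuns_entry[OF that]]
    by (simp add: vector_derivative_works)
  have "((\<lambda>t. \<Sum>i<N. P t $$ (r, i) * Q t $$ (i, c)) has_vector_derivative
      (\<Sum>i<N. P x $$ (r, i) * mderiv N Q x $$ (i, c) + mderiv N P x $$ (r, i) * Q x $$ (i, c))) (at x)"
    by (intro has_vector_derivative_sum has_vector_derivative_mult entry) (use P Q rc in auto)
  then have "vector_derivative (\<lambda>t. \<Sum>i<N. P t $$ (r, i) * Q t $$ (i, c)) (at x)
      = (\<Sum>i<N. P x $$ (r, i) * mderiv N Q x $$ (i, c) + mderiv N P x $$ (r, i) * Q x $$ (i, c))"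
    by (rule vector_derivative_at)
  moreover have "(\<lambda>t. (P t * Q t) $$ (r, c)) = (\<lambda>t. \<Sum>i<N. P t $$ (r, i) * Q t $$ (i, c))"
    using rc P Q by (simp add: mult_mat_index[of _ N] del: index_mult_mat(1))
  moreover have "(mderiv N P x * Q x) $$ (r, c) = (\<Sum>i<N. mderiv N P x $$ (r, i) * Q x $$ (i, c))"
      "(P x * mderiv N Q x) $$ (r, c) = (\<Sum>i<N. P x $$ (r, i) * mderiv N Q x $$ (i, c))"
    using rc P Q by (simp_all add: mult_mat_index[of _ N] del: index_mult_mat(1) mderiv_index)
  ultimately show "mderiv N (\<lambda>x. P x * Q x) x $$ (r, c)
      = (mderiv N P x * Q x + P x * mderiv N Q x) $$ (r, c)"
    using rc P Q by (simp add: sum.distrib del: index_mult_mat(1))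
qed (use smooth_mfunsD[OF assms(1)] smooth_mfunsD[OF assms(2)] in auto)

section \<open>The vector space of differential operators\<close>

lemma funpow_mderiv_smooth_mfuns:
  "P \<in> smooth_mfuns N \<Longrightarrow> (mderiv N ^^ j) P \<in> smooth_mfuns N"
  by (induction j) (auto intro: smooth_mfuns_mderiv)

lemma diffop_apply:
  "P \<in> smooth_mfuns N \<Longrightarrow> diffop N Fs P x =
    mat N N (\<lambda>(r, c). \<Sum>j<length Fs. ((mderiv N ^^ j) P x * (Fs ! j) x) $$ (r, c))"
  by (simp add: diffop_def)

text \<open>Padding a coefficient list with zeros, so that operators of different order can be added
coefficientwise.\<close>

definition coeff_at :: "nat \<Rightarrow> (real \<Rightarrow> complex mat) list \<Rightarrow> nat \<Rightarrow> real \<Rightarrow> complex mat" where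
  "coeff_at N Fs j = (if j < length Fs then Fs ! j else (\<lambda>x. 0\<^sub>m N N))"

lemma coeff_at_smooth:
  assumes "set Fs \<subseteq> smooth_mfuns N"
  shows "coeff_at N Fs j \<in> smooth_mfuns N"
  using assms nth_mem[of j Fs] by (auto simp: coeff_at_def smooth_mfuns_const)

lemma diffop_apply_padded:
  assumes P: "P \<in> smooth_mfuns N" and n: "length Fs \<le> n"
  shows "diffop N Fs P x =
    mat N N (\<lambda>(r, c). \<Sum>j<n. ((mderiv N ^^ j) P x * coeff_at N Fs j x) $$ (r, c))"
proof (rule eq_matI)
  fix r c
  assume "r < dim_row (mat N N (\<lambda>(r, c). \<Sum>j<n. ((mderiv N ^^ j) P x * coeff_at N Fs j x) $$ (r, c)))"
    "c < dim_col (mat N N (\<lambda>(r, c). \<Sum>j<n. ((mderiv N ^^ j) P x * coeff_at N Fs j x) $$ (r, c)))"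
  then have rc: "r < N" "c < N" by auto
  have zero: "((mderiv N ^^ j) P x * coeff_at N Fs j x) $$ (r, c) = 0"
    if "j \<in> {..<n} - {..<length Fs}" for j
    using that rc smooth_mfuns_carrier[OF funpow_mderiv_smooth_mfuns[OF P], of j x]
    by (auto simp: coeff_at_def)
  have "(\<Sum>j<n. ((mderiv N ^^ j) P x * coeff_at N Fs j x) $$ (r, c))
     = (\<Sum>j<length Fs. ((mderiv N ^^ j) P x * coeff_at N Fs j x) $$ (r, c))"
    using n by (intro sum.mono_neutral_right) (auto simp: zero simp del: index_mult_mat(1))
  then show "diffop N Fs P x $$ (r, c) =
      mat N N (\<lambda>(r, c). \<Sum>j<n. ((mderiv N ^^ j) P x * coeff_at N Fs j x) $$ (r, c)) $$ (r, c)"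
    using rc P by (simp add: diffop_apply coeff_at_def del: index_mult_mat(1))
qed (use P in \<open>simp_all add: diffop_apply\<close>)

lemma diffop_lie_simps [simp]:
  "zero (diffop_lie N) = (\<lambda>P \<in> smooth_mfuns N. \<lambda>x. 0\<^sub>m N N)"
  "add (diffop_lie N) = (\<lambda>E1 E2. \<lambda>P \<in> smooth_mfuns N. \<lambda>x. E1 P x + E2 P x)"
  "module.smult (diffop_lie N) = (\<lambda>c E. \<lambda>P \<in> smooth_mfuns N. \<lambda>x. c \<cdot>\<^sub>m E P x)"
  by (simp_all add: diffop_lie_def)

lemma diffop_lie_carrierE:
  assumes "E \<in> carrier (diffop_lie N)"
  obtains Fs where "E = diffop N Fs" "set Fs \<subseteq> smooth_mfuns N"
  using assms by (auto simp: diffop_lie_def)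

lemma diffop_lie_carrierI: "set Fs \<subseteq> smooth_mfuns N \<Longrightarrow> diffop N Fs \<in> carrier (diffop_lie N)"
  by (auto simp: diffop_lie_def)

lemma diffop_lie_extensional: "E \<in> carrier (diffop_lie N) \<Longrightarrow> E \<in> extensional (smooth_mfuns N)"
  by (auto elim!: diffop_lie_carrierE simp: diffop_def)

lemma diffop_lie_value:
  "E \<in> carrier (diffop_lie N) \<Longrightarrow> P \<in> smooth_mfuns N \<Longrightarrow> E P x \<in> carrier_mat N N"
  by (auto elim!: diffop_lie_carrierE simp: diffop_apply)

lemma operator_eqI:
  assumes "E \<in> extensional (smooth_mfuns N)" "F \<in> extensional (smooth_mfuns N)"
    and "\<And>P x. P \<in> smooth_mfuns N \<Longrightarrow> E P x = F P x"
  shows "E = F"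
  using assms by (intro extensionalityI[of _ "smooth_mfuns N"]) auto

lemma diffop_lie_add_closed:
  assumes "E \<in> carrier (diffop_lie N)" "F \<in> carrier (diffop_lie N)"
  shows "E \<oplus>\<^bsub>diffop_lie N\<^esub> F \<in> carrier (diffop_lie N)"
proof -
  obtain Fs where Fs: "E = diffop N Fs" "set Fs \<subseteq> smooth_mfuns N"
    using assms(1) by (rule diffop_lie_carrierE)
  obtain Gs where Gs: "F = diffop N Gs" "set Gs \<subseteq> smooth_mfuns N"
    using assms(2) by (rule diffop_lie_carrierE)
  define n where "n = max (length Fs) (length Gs)"
  define Hs where "Hs = map (\<lambda>j x. coeff_at N Fs j x + coeff_at N Gs j x) [0..<n]"
  have len: "length Fs \<le> n" "length Gs \<le> n" "length Hs \<le> n"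
    by (simp_all add: n_def Hs_def)
  have Hs_smooth: "set Hs \<subseteq> smooth_mfuns N"
    using coeff_at_smooth[OF Fs(2)] coeff_at_smooth[OF Gs(2)]
    by (auto simp: Hs_def smooth_mfuns_add)
  have "E \<oplus>\<^bsub>diffop_lie N\<^esub> F = diffop N Hs"
  proof (rule operator_eqI[of _ N])
    fix P x assume P: "P \<in> smooth_mfuns N"
    have carrier: "(mderiv N ^^ j) P x \<in> carrier_mat N N" for j
      using P by (intro smooth_mfuns_carrier funpow_mderiv_smooth_mfuns)
    note [simp] = carrier_matD[OF carrier]
      smooth_mfunsD[OF coeff_at_smooth[OF Fs(2)]] smooth_mfunsD[OF coeff_at_smooth[OF Gs(2)]]
    have split: "(mderiv N ^^ j) P x * (coeff_at N Fs j x + coeff_at N Gs j x)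
       = (mderiv N ^^ j) P x * coeff_at N Fs j x + (mderiv N ^^ j) P x * coeff_at N Gs j x" for j
      by (rule mult_add_distrib_mat[OF carrier, of _ N]) simp_all
    have Hs_at: "coeff_at N Hs j x = coeff_at N Fs j x + coeff_at N Gs j x" if "j < n" for j
      using that by (simp add: Hs_def coeff_at_def)
    have "diffop N Fs P x + diffop N Gs P x = diffop N Hs P x"
      using P by (intro eq_matI)
        (simp_all add: diffop_apply_padded[OF P len(1)] diffop_apply_padded[OF P len(2)]
          diffop_apply_padded[OF P len(3)] split Hs_at sum.distrib del: index_mult_mat(1))
    then show "(E \<oplus>\<^bsub>diffop_lie N\<^esub> F) P x = diffop N Hs P x"
      using P by (simp add: Fs Gs)
  qed (auto simp: diffop_def)
  then show ?thesis
    using Hs_smooth by (simp only: diffop_lie_carrierI)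
qed

lemma diffop_lie_smult_closed:
  assumes "E \<in> carrier (diffop_lie N)"
  shows "k \<odot>\<^bsub>diffop_lie N\<^esub> E \<in> carrier (diffop_lie N)"
proof -
  obtain Fs where Fs: "E = diffop N Fs" "set Fs \<subseteq> smooth_mfuns N"
    using assms(1) by (rule diffop_lie_carrierE)
  define Hs where "Hs = map (\<lambda>F x. k \<cdot>\<^sub>m F x) Fs"
  have Hs_smooth: "set Hs \<subseteq> smooth_mfuns N"
    using Fs(2) by (auto simp: Hs_def intro!: smooth_mfuns_smult smooth_const)
  have "k \<odot>\<^bsub>diffop_lie N\<^esub> E = diffop N Hs"
  proof (rule operator_eqI[of _ N])
    fix P x assume P: "P \<in> smooth_mfuns N"
    have carrier: "(mderiv N ^^ j) P x \<in> carrier_mat N N" for j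
      using P by (intro smooth_mfuns_carrier funpow_mderiv_smooth_mfuns)
    have Fs_carrier: "(Fs ! j) x \<in> carrier_mat N N" if "j < length Fs" for j
      using that Fs(2) nth_mem by (blast intro: smooth_mfuns_carrier)
    note [simp] = carrier_matD[OF carrier] carrier_matD[OF Fs_carrier]
    have "(mderiv N ^^ j) P x * (k \<cdot>\<^sub>m (Fs ! j) x) = k \<cdot>\<^sub>m ((mderiv N ^^ j) P x * (Fs ! j) x)"
      if "j < length Fs" for j
      by (rule mult_smult_distrib[OF carrier Fs_carrier[OF that]])
    then have "k \<cdot>\<^sub>m diffop N Fs P x = diffop N Hs P x"
      using P by (intro eq_matI)
        (simp_all add: diffop_apply Hs_def sum_distrib_left del: index_mult_mat(1))
    then show "(k \<odot>\<^bsub>diffop_lie N\<^esub> E) P x = diffop N Hs P x"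
      using P by (simp add: Fs)
  qed (auto simp: diffop_def)
  then show ?thesis
    using Hs_smooth by (simp only: diffop_lie_carrierI)
qed

lemma diffop_lie_zero_closed: "\<zero>\<^bsub>diffop_lie N\<^esub> \<in> carrier (diffop_lie N)"
proof -
  have "\<zero>\<^bsub>diffop_lie N\<^esub> = diffop N []"
    by (rule operator_eqI[of _ N]) (auto simp: diffop_def intro!: eq_matI)
  then show ?thesis
    by (simp only: diffop_lie_carrierI list.set empty_subsetI)
qed

text \<open>Spans are taken inside the space of all differential operators, so this space has to be
a vector space before anything can be said about the span of the generators.\<close>

lemma vectorspace_diffop_lie: "vectorspace (class_ring :: complex ring) (diffop_lie N)"
proof (rule vs_criteria)
  show "field (class_ring :: complex ring)" by (rule class_field)
  show "\<zero>\<^bsub>diffop_lie N\<^esub> \<in> carrier (diffop_lie N)" by (rule diffop_lie_zero_closed)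
  let ?C = "carrier (diffop_lie N)"
  note eqI = operator_eqI[of _ N]
  note ext = diffop_lie_extensional
  have dims: "dim_row (v P x) = N" "dim_col (v P x) = N" if "v \<in> ?C" "P \<in> smooth_mfuns N" for v P x
    using diffop_lie_value[OF that, of x] by auto
  show "\<forall>v w. v \<in> ?C \<and> w \<in> ?C \<longrightarrow> v \<oplus>\<^bsub>diffop_lie N\<^esub> w \<in> ?C"
    by (blast intro: diffop_lie_add_closed)
  show "\<forall>c v. c \<in> carrier (class_ring :: complex ring) \<and> v \<in> ?C \<longrightarrow> c \<odot>\<^bsub>diffop_lie N\<^esub> v \<in> ?C"
    by (blast intro: diffop_lie_smult_closed)
  show "\<forall>v\<in>?C. \<exists>neg_v\<in>?C. v \<oplus>\<^bsub>diffop_lie N\<^esub> neg_v = \<zero>\<^bsub>diffop_lie N\<^esub>"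
  proof
    fix v assume v: "v \<in> ?C"
    have "v \<oplus>\<^bsub>diffop_lie N\<^esub> ((- 1) \<odot>\<^bsub>diffop_lie N\<^esub> v) = \<zero>\<^bsub>diffop_lie N\<^esub>"
    proof (rule eqI)
      fix P x assume P: "P \<in> smooth_mfuns N"
      show "(v \<oplus>\<^bsub>diffop_lie N\<^esub> ((- 1) \<odot>\<^bsub>diffop_lie N\<^esub> v)) P x = \<zero>\<^bsub>diffop_lie N\<^esub> P x"
        using dims[OF v P, of x] P by (auto intro!: eq_matI)
    qed auto
    then show "\<exists>neg_v\<in>?C. v \<oplus>\<^bsub>diffop_lie N\<^esub> neg_v = \<zero>\<^bsub>diffop_lie N\<^esub>"
      using diffop_lie_smult_closed[OF v] by blast
  qed
  show "\<forall>v w. v \<in> ?C \<and> w \<in> ?C \<longrightarrow> v \<oplus>\<^bsub>diffop_lie N\<^esub> w = w \<oplus>\<^bsub>diffop_lie N\<^esub> v"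
    by (auto intro!: eqI eq_matI simp: dims algebra_simps)
  show "\<forall>v w x. v \<in> ?C \<and> w \<in> ?C \<and> x \<in> ?C \<longrightarrow>
      v \<oplus>\<^bsub>diffop_lie N\<^esub> w \<oplus>\<^bsub>diffop_lie N\<^esub> x = v \<oplus>\<^bsub>diffop_lie N\<^esub> (w \<oplus>\<^bsub>diffop_lie N\<^esub> x)"
    by (auto intro!: eqI eq_matI simp: dims algebra_simps)
  show "\<forall>v\<in>?C. v \<oplus>\<^bsub>diffop_lie N\<^esub> \<zero>\<^bsub>diffop_lie N\<^esub> = v"
    by (auto intro!: eqI eq_matI simp: dims ext)
  show "\<forall>a b v. a \<in> carrier (class_ring :: complex ring) \<and> b \<in> carrier (class_ring :: complex ring) \<and> v \<in> ?C \<longrightarrow>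
      (a \<otimes>\<^bsub>class_ring\<^esub> b) \<odot>\<^bsub>diffop_lie N\<^esub> v = a \<odot>\<^bsub>diffop_lie N\<^esub> (b \<odot>\<^bsub>diffop_lie N\<^esub> v)"
    by (auto intro!: eqI eq_matI simp: dims)
  show "\<forall>v\<in>?C. \<one>\<^bsub>class_ring\<^esub> \<odot>\<^bsub>diffop_lie N\<^esub> v = v"
    by (auto intro!: eqI eq_matI simp: dims ext)
  show "\<forall>a b v. a \<in> carrier (class_ring :: complex ring) \<and> b \<in> carrier (class_ring :: complex ring) \<and> v \<in> ?C \<longrightarrow>
      (a \<oplus>\<^bsub>class_ring\<^esub> b) \<odot>\<^bsub>diffop_lie N\<^esub> v = a \<odot>\<^bsub>diffop_lie N\<^esub> v \<oplus>\<^bsub>diffop_lie N\<^esub> b \<odot>\<^bsub>diffop_lie N\<^esub> v"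
    by (auto intro!: eqI eq_matI simp: dims algebra_simps)
  show "\<forall>a v w. a \<in> carrier (class_ring :: complex ring) \<and> v \<in> ?C \<and> w \<in> ?C \<longrightarrow>
      a \<odot>\<^bsub>diffop_lie N\<^esub> (v \<oplus>\<^bsub>diffop_lie N\<^esub> w) = a \<odot>\<^bsub>diffop_lie N\<^esub> v \<oplus>\<^bsub>diffop_lie N\<^esub> a \<odot>\<^bsub>diffop_lie N\<^esub> w"
    by (auto intro!: eqI eq_matI simp: dims algebra_simps)
qed

section \<open>First order operators\<close>

text \<open>The derivative enters only through the scalar operator \<open>x \<partial>\<^sub>x\<close>, as in \<open>\<D>\<close> and \<open>\<D>\<dagger>\<close>; for
this shape commutators stay of first order.\<close>

definition first_order_op :: "nat \<Rightarrow> complex \<Rightarrow> (real \<Rightarrow> complex mat) \<Rightarrow> operator" where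
  "first_order_op N \<alpha> M =
     (\<lambda>P \<in> smooth_mfuns N. \<lambda>x. P x * M x + (\<alpha> * complex_of_real x) \<cdot>\<^sub>m mderiv N P x)"

lemma diffop_eq_first_order_op:
  assumes M: "M \<in> smooth_mfuns N"
  shows "diffop N [M, scalar_mfun N (\<lambda>x. \<alpha> * complex_of_real x)] = first_order_op N \<alpha> M"
proof (rule operator_eqI[of _ N])
  fix P x assume P: "P \<in> smooth_mfuns N"
  note [simp] = smooth_mfunsD[OF P] smooth_mfunsD[OF M]
  have "mderiv N P x * scalar_mfun N (\<lambda>x. \<alpha> * complex_of_real x) x
      = (\<alpha> * complex_of_real x) \<cdot>\<^sub>m mderiv N P x"
    by (simp add: scalar_mfun_def mult_smult_distrib[of _ N N _ N])
  then show "diffop N [M, scalar_mfun N (\<lambda>x. \<alpha> * complex_of_real x)] P x = first_order_op N \<alpha> M P x"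
    using P by (intro eq_matI)
      (simp_all add: diffop_apply first_order_op_def lessThan_Suc del: index_mult_mat(1))
qed (auto simp: diffop_def first_order_op_def)

lemma diffop_eq_first_order_op_0:
  assumes M: "M \<in> smooth_mfuns N"
  shows "diffop N [M] = first_order_op N 0 M"
proof (rule operator_eqI[of _ N])
  fix P x assume P: "P \<in> smooth_mfuns N"
  note [simp] = smooth_mfunsD[OF P] smooth_mfunsD[OF M]
  show "diffop N [M] P x = first_order_op N 0 M P x"
    using P by (intro eq_matI)
      (simp_all add: diffop_apply first_order_op_def lessThan_Suc del: index_mult_mat(1))
qed (auto simp: diffop_def first_order_op_def)

lemma first_order_op_carrier:
  assumes "M \<in> smooth_mfuns N"
  shows "first_order_op N \<alpha> M \<in> carrier (diffop_lie N)"
  using assms unfolding diffop_eq_first_order_op[OF assms, symmetric]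
  by (intro diffop_lie_carrierI)
     (auto intro!: smooth_mfuns_scalar smooth_mult smooth_const smooth_of_real)

lemma first_order_op_smooth:
  assumes "M \<in> smooth_mfuns N" "P \<in> smooth_mfuns N"
  shows "first_order_op N \<alpha> M P \<in> smooth_mfuns N"
  using assms unfolding first_order_op_def
  by (auto intro!: smooth_mfuns_add smooth_mfuns_mult smooth_mfuns_smult smooth_mfuns_mderiv
      smooth_mult smooth_const smooth_of_real)

lemma first_order_op_compose:
  assumes M: "M \<in> smooth_mfuns N" and K: "K \<in> smooth_mfuns N" and P: "P \<in> smooth_mfuns N"
  shows "first_order_op N \<beta> K (first_order_op N \<alpha> M P) x =
    P x * M x * K x + (\<alpha> * complex_of_real x) \<cdot>\<^sub>m (mderiv N P x * K x)
    + (\<beta> * complex_of_real x) \<cdot>\<^sub>m (mderiv N P x * M x + P x * mderiv N M x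
        + (\<alpha> \<cdot>\<^sub>m mderiv N P x + (\<alpha> * complex_of_real x) \<cdot>\<^sub>m mderiv N (mderiv N P) x))"
proof -
  have P': "mderiv N P \<in> smooth_mfuns N" using P by (rule smooth_mfuns_mderiv)
  have lin: "smooth (\<lambda>x. \<alpha> * complex_of_real x)"
    by (intro smooth_mult smooth_const smooth_of_real)
  have lin': "vector_derivative (\<lambda>x. \<alpha> * complex_of_real x) (at x) = \<alpha>"
    using vector_derivative_poly[of "[:0, \<alpha>:]" x] by (simp add: mult.commute pderiv_pCons)
  have "mderiv N (first_order_op N \<alpha> M P) x =
      mderiv N P x * M x + P x * mderiv N M x
        + (\<alpha> \<cdot>\<^sub>m mderiv N P x + (\<alpha> * complex_of_real x) \<cdot>\<^sub>m mderiv N (mderiv N P) x)"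
    using P unfolding first_order_op_def
    by (simp add: mderiv_add[OF smooth_mfuns_mult[OF P M] smooth_mfuns_smult[OF P' lin]]
        mderiv_mult[OF P M] mderiv_smult[OF P' lin] lin')
  moreover have "first_order_op N \<alpha> M P x * K x =
      P x * M x * K x + (\<alpha> * complex_of_real x) \<cdot>\<^sub>m (mderiv N P x * K x)"
    using P smooth_mfunsD[OF M, of x] smooth_mfunsD[OF K, of x] smooth_mfunsD[OF P, of x]
    by (simp add: first_order_op_def add_mult_distrib_mat[of _ N N _ _ N]
        mult_smult_assoc_mat[of _ N N _ N] mult_carrier_mat[of _ N N])
  ultimately show ?thesis
    using first_order_op_smooth[OF M P] by (subst first_order_op_def) simp
qed

text \<open>The terms with \<open>P'\<close> and \<open>P''\<close> are symmetric under exchange of the two operators, because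
\<open>\<alpha> x\<close> and \<open>\<beta> x\<close> are scalar multiples of the same function; so the commutator has order zero.\<close>

lemma bracket_first_order_op:
  assumes M: "M \<in> smooth_mfuns N" and K: "K \<in> smooth_mfuns N" and L: "L \<in> smooth_mfuns N"
    and L_eq: "\<And>x. L x = M x * K x - K x * M x
      + complex_of_real x \<cdot>\<^sub>m (\<beta> \<cdot>\<^sub>m mderiv N M x - \<alpha> \<cdot>\<^sub>m mderiv N K x)"
  shows "lie_bracket (diffop_lie N) (first_order_op N \<alpha> M) (first_order_op N \<beta> K)
    = first_order_op N 0 L"
proof (rule operator_eqI[of _ N])
  fix P x assume P: "P \<in> smooth_mfuns N"
  note [simp] = smooth_mfunsD[OF P] smooth_mfunsD[OF M] smooth_mfunsD[OF K] smooth_mfunsD[OF L]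
    mult_carrier_mat[of _ N N _ N]
  have "P x * L x = P x * M x * K x - P x * K x * M x
      + complex_of_real x \<cdot>\<^sub>m (\<beta> \<cdot>\<^sub>m (P x * mderiv N M x) - \<alpha> \<cdot>\<^sub>m (P x * mderiv N K x))"
    unfolding L_eq
    by (simp add: mult_add_distrib_mat[of _ N N _ N] mult_minus_distrib_mat[of _ N N _ N]
        mult_smult_distrib[of _ N N _ N] assoc_mult_mat[of _ N N _ N _ N] minus_carrier_mat)
  then show "lie_bracket (diffop_lie N) (first_order_op N \<alpha> M) (first_order_op N \<beta> K) P x
      = first_order_op N 0 L P x"
    using P
    by (intro eq_matI)
       (simp_all add: diffop_lie_def op_mult_def first_order_op_compose[OF M K P]
         first_order_op_compose[OF K M P] first_order_op_def[of N 0] algebra_simps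
         del: index_mult_mat(1) mderiv_index)
qed (auto simp: diffop_lie_def first_order_op_def)

lemma first_order_op_add:
  assumes M: "M \<in> smooth_mfuns N" and K: "K \<in> smooth_mfuns N" and "\<And>x. L x = M x + K x"
  shows "first_order_op N (\<alpha> + \<beta>) L = first_order_op N \<alpha> M \<oplus>\<^bsub>diffop_lie N\<^esub> first_order_op N \<beta> K"
proof (rule operator_eqI[of _ N])
  fix P x assume P: "P \<in> smooth_mfuns N"
  note [simp] = smooth_mfunsD[OF P] smooth_mfunsD[OF M] smooth_mfunsD[OF K]
  show "first_order_op N (\<alpha> + \<beta>) L P x
      = (first_order_op N \<alpha> M \<oplus>\<^bsub>diffop_lie N\<^esub> first_order_op N \<beta> K) P x"
    using P by (intro eq_matI)
      (simp_all add: first_order_op_def assms(3) mult_add_distrib_mat[of _ N N _ N] ring_distribs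
        del: index_mult_mat(1))
qed (auto simp: first_order_op_def)

lemma first_order_op_smult:
  assumes M: "M \<in> smooth_mfuns N" and "\<And>x. L x = k \<cdot>\<^sub>m M x"
  shows "first_order_op N (k * \<alpha>) L = k \<odot>\<^bsub>diffop_lie N\<^esub> first_order_op N \<alpha> M"
proof (rule operator_eqI[of _ N])
  fix P x assume P: "P \<in> smooth_mfuns N"
  note [simp] = smooth_mfunsD[OF P] smooth_mfunsD[OF M]
  show "first_order_op N (k * \<alpha>) L P x = (k \<odot>\<^bsub>diffop_lie N\<^esub> first_order_op N \<alpha> M) P x"
    using P by (intro eq_matI)
      (simp_all add: first_order_op_def assms(2) mult_smult_distrib[of _ N N _ N] ring_distribs
        del: index_mult_mat(1))
qed (auto simp: first_order_op_def)

text \<open>The constant function \<open>1\<close> recovers the matrix coefficient and the function \<open>x\<close> then recovers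
\<open>\<alpha>\<close>.\<close>

lemma first_order_op_inject:
  assumes M: "M \<in> smooth_mfuns N" and K: "K \<in> smooth_mfuns N" and "N > 0"
    and eq: "first_order_op N \<alpha> M = first_order_op N \<beta> K"
  shows "M = K" "\<alpha> = \<beta>"
proof -
  have id: "(\<lambda>x. 1\<^sub>m N) \<in> smooth_mfuns N"
    by (simp add: smooth_mfuns_const)
  have value_id: "first_order_op N \<gamma> L (\<lambda>x. 1\<^sub>m N) x = L x"
    if L: "L \<in> smooth_mfuns N" for \<gamma> L x
  proof -
    have "mderiv N (\<lambda>x. 1\<^sub>m N) x = 0\<^sub>m N N"
      by (rule eq_matI) simp_all
    then show ?thesis
      using id smooth_mfuns_carrier[OF L, of x]
      by (simp add: first_order_op_def left_mult_one_mat[of _ N N] right_add_zero_mat[of _ N N])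
  qed
  show MK: "M = K"
  proof
    show "M x = K x" for x
      using value_id[OF M, of \<alpha> x] value_id[OF K, of \<beta> x] eq by metis
  qed
  have lin: "scalar_mfun N complex_of_real \<in> smooth_mfuns N"
    by (simp add: smooth_mfuns_scalar smooth_of_real)
  have value_lin: "first_order_op N \<gamma> M (scalar_mfun N complex_of_real) 1 = M 1 + \<gamma> \<cdot>\<^sub>m 1\<^sub>m N" for \<gamma>
  proof -
    have "mderiv N (scalar_mfun N complex_of_real) 1 = 1\<^sub>m N"
    proof (rule eq_matI)
      fix r c assume "r < dim_row (1\<^sub>m N :: complex mat)" "c < dim_col (1\<^sub>m N :: complex mat)"
      then show "mderiv N (scalar_mfun N complex_of_real) 1 $$ (r, c) = 1\<^sub>m N $$ (r, c)"
        by (cases "r = c") (simp_all add: scalar_mfun_def vector_derivative_of_real)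
    qed simp_all
    moreover have "scalar_mfun N complex_of_real 1 = 1\<^sub>m N"
      by (rule eq_matI) (simp_all add: scalar_mfun_def)
    ultimately show ?thesis
      using lin smooth_mfuns_carrier[OF M, of 1]
      by (simp add: first_order_op_def left_mult_one_mat[of _ N N])
  qed
  have "M 1 + \<alpha> \<cdot>\<^sub>m 1\<^sub>m N = M 1 + \<beta> \<cdot>\<^sub>m 1\<^sub>m N"
    using value_lin[of \<alpha>] value_lin[of \<beta>] eq MK by metis
  then have "(M 1 + \<alpha> \<cdot>\<^sub>m 1\<^sub>m N) $$ (0, 0) = (M 1 + \<beta> \<cdot>\<^sub>m 1\<^sub>m N) $$ (0, 0)"
    by (rule arg_cong)
  then show "\<alpha> = \<beta>"
    using \<open>N > 0\<close> by simp
qed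

section \<open>A bidiagonal normal form\<close>

text \<open>The entries of \<open>(c + \<alpha>) x A - c J + p(x)\<close>, kept as polynomials so that they can be
differentiated formally.\<close>

definition coeff_entry :: "(nat \<Rightarrow> real) \<Rightarrow> complex \<Rightarrow> complex \<Rightarrow> complex poly \<Rightarrow> nat \<Rightarrow> nat \<Rightarrow> complex poly" where
  "coeff_entry a c \<alpha> p r s =
    (if r = s then p - [:c * of_nat (r + 1):]
     else if r = s + 1 then [:0, (c + \<alpha>) * complex_of_real (a (s + 1)):] else 0)"

definition coeff_mfun ::
  "nat \<Rightarrow> (nat \<Rightarrow> real) \<Rightarrow> complex \<Rightarrow> complex \<Rightarrow> complex poly \<Rightarrow> real \<Rightarrow> complex mat" where
  "coeff_mfun N a c \<alpha> p = (\<lambda>x. mat N N (\<lambda>(r, s). poly (coeff_entry a c \<alpha> p r s) (complex_of_real x)))"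

definition normal_op ::
  "nat \<Rightarrow> (nat \<Rightarrow> real) \<Rightarrow> complex \<Rightarrow> complex \<Rightarrow> complex poly \<Rightarrow> operator" where
  "normal_op N a c \<alpha> p = first_order_op N \<alpha> (coeff_mfun N a c \<alpha> p)"

lemma coeff_mfun_smooth: "coeff_mfun N a c \<alpha> p \<in> smooth_mfuns N"
  by (rule smooth_mfunsI) (simp_all add: coeff_mfun_def smooth_poly)

lemma mderiv_coeff_mfun:
  "r < N \<Longrightarrow> s < N \<Longrightarrow> mderiv N (coeff_mfun N a c \<alpha> p) x $$ (r, s)
    = poly (pderiv (coeff_entry a c \<alpha> p r s)) (complex_of_real x)"
  by (simp add: coeff_mfun_def vector_derivative_poly)

lemma normal_op_carrier: "normal_op N a c \<alpha> p \<in> carrier (diffop_lie N)"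
  unfolding normal_op_def by (rule first_order_op_carrier[OF coeff_mfun_smooth])

lemma normal_op_add:
  "normal_op N a c \<alpha> p \<oplus>\<^bsub>diffop_lie N\<^esub> normal_op N a d \<beta> q = normal_op N a (c + d) (\<alpha> + \<beta>) (p + q)"
  unfolding normal_op_def
  by (rule first_order_op_add[symmetric, OF coeff_mfun_smooth coeff_mfun_smooth], rule eq_matI)
     (auto simp: coeff_mfun_def coeff_entry_def algebra_simps)

lemma normal_op_smult:
  "k \<odot>\<^bsub>diffop_lie N\<^esub> normal_op N a c \<alpha> p = normal_op N a (k * c) (k * \<alpha>) (Polynomial.smult k p)"
  unfolding normal_op_def
  by (rule first_order_op_smult[symmetric, OF coeff_mfun_smooth], rule eq_matI)
     (auto simp: coeff_mfun_def coeff_entry_def algebra_simps)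

lemma normal_op_zero: "normal_op N a 0 0 0 = \<zero>\<^bsub>diffop_lie N\<^esub>"
proof (rule operator_eqI[of _ N])
  fix P x assume P: "P \<in> smooth_mfuns N"
  have "coeff_mfun N a 0 0 0 x = 0\<^sub>m N N"
    by (rule eq_matI) (auto simp: coeff_mfun_def coeff_entry_def)
  then show "normal_op N a 0 0 0 P x = \<zero>\<^bsub>diffop_lie N\<^esub> P x"
    using P smooth_mfunsD[OF P, of x] by (auto simp: normal_op_def first_order_op_def intro!: eq_matI)
qed (auto simp: normal_op_def first_order_op_def)

text \<open>On the diagonal of the matrix coefficient stand \<open>p(x) - c\<close> and \<open>p(x) - 2 c\<close>. Their difference
is \<open>c\<close>, and then \<open>p\<close> is determined by its values at more points than its degree.\<close>

lemma normal_op_inject: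
  assumes "N \<ge> 2" and eq: "normal_op N a c \<alpha> p = normal_op N a d \<beta> q"
  shows "c = d \<and> \<alpha> = \<beta> \<and> p = q"
proof -
  have "\<alpha> = \<beta>" and M: "coeff_mfun N a c \<alpha> p = coeff_mfun N a d \<beta> q"
    using first_order_op_inject[OF coeff_mfun_smooth coeff_mfun_smooth _ eq[unfolded normal_op_def]] assms(1)
    by auto
  have entry: "poly (coeff_entry a c \<alpha> p r s) (complex_of_real x)
      = poly (coeff_entry a d \<beta> q r s) (complex_of_real x)" if "r < N" "s < N" for r s x
    using that fun_cong[OF M, of x] by (metis (no_types, lifting) coeff_mfun_def case_prod_conv index_mat(1))
  have diag: "poly p (complex_of_real x) - c * of_nat (r + 1) = poly q (complex_of_real x) - d * of_nat (r + 1)"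
    if "r < N" for r x
    using entry[OF that that, of x] by (simp add: coeff_entry_def)
  have "c = d"
  proof -
    have "poly p 0 - c = poly q 0 - d" "poly p 0 - c * 2 = poly q 0 - d * 2"
      using diag[of 0 0] diag[of 1 0] assms(1) by simp_all
    then have "(poly p 0 - c) - (poly p 0 - c * 2) = (poly q 0 - d) - (poly q 0 - d * 2)"
      by simp
    then show ?thesis by simp
  qed
  moreover have "p = q"
  proof (rule poly_eqI_degree[of "complex_of_real ` real ` {..max (degree p) (degree q)}"])
    have "card (complex_of_real ` real ` {..max (degree p) (degree q)}) = Suc (max (degree p) (degree q))"
      by (simp add: card_image inj_on_def)
    then show "card (complex_of_real ` real ` {..max (degree p) (degree q)}) > degree p"
        "card (complex_of_real ` real ` {..max (degree p) (degree q)}) > degree q"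
      by simp_all
  qed (use diag[of 0] assms(1) \<open>c = d\<close> in auto)
  ultimately show ?thesis
    using \<open>\<alpha> = \<beta>\<close> by simp
qed

text \<open>A row of a lower bidiagonal matrix has at most two nonzero entries.\<close>

lemma bidiagonal_mult_index:
  fixes M K :: "complex mat"
  assumes "M \<in> carrier_mat N N" "K \<in> carrier_mat N N" "i < N" "j < N"
    and zero: "\<And>l. l < N \<Longrightarrow> l \<noteq> i \<Longrightarrow> i \<noteq> l + 1 \<Longrightarrow> M $$ (i, l) = 0"
  shows "(M * K) $$ (i, j)
    = M $$ (i, i) * K $$ (i, j) + (if i = 0 then 0 else M $$ (i, i - 1) * K $$ (i - 1, j))"
proof -
  have "(M * K) $$ (i, j) = (\<Sum>l<N. M $$ (i, l) * K $$ (l, j))"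
    using assms by (simp add: mult_mat_index[of _ N] del: index_mult_mat(1))
  also have "\<dots> = (\<Sum>l\<in>insert i {l. i = l + 1}. M $$ (i, l) * K $$ (l, j))"
    using assms(3) zero by (intro sum.mono_neutral_right) auto
  also have "\<dots> = M $$ (i, i) * K $$ (i, j) + (\<Sum>l\<in>{l. i = l + 1}. M $$ (i, l) * K $$ (l, j))"
  proof (rule sum.insert)
    show "finite {l. i = l + 1}" by (rule finite_subset[of _ "{..i}"]) auto
  qed simp
  also have "{l. i = l + 1} = (if i = 0 then {} else {i - 1})"
    by auto
  finally show ?thesis by (simp split: if_splits)
qed

text \<open>The matrix coefficients commute on the diagonal and two steps below it. On the subdiagonal,
\<open>[J, A] = A\<close> gives \<open>(\<alpha> d - \<beta> c) x A\<close> for the commutator of the coefficients, and the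
derivative terms contribute the negative of that.\<close>

lemma bracket_normal_op:
  "lie_bracket (diffop_lie N) (normal_op N a c \<alpha> p) (normal_op N a d \<beta> q)
    = normal_op N a 0 0 (monom 1 1 * (Polynomial.smult \<beta> (pderiv p) - Polynomial.smult \<alpha> (pderiv q)))"
  unfolding normal_op_def
proof (rule bracket_first_order_op[OF coeff_mfun_smooth coeff_mfun_smooth coeff_mfun_smooth])
  fix x
  let ?L = "coeff_mfun N a 0 0 (monom 1 1 * (Polynomial.smult \<beta> (pderiv p) - Polynomial.smult \<alpha> (pderiv q)))"
  let ?M = "coeff_mfun N a c \<alpha> p" and ?K = "coeff_mfun N a d \<beta> q"
  show "?L x = ?M x * ?K x - ?K x * ?M x
      + complex_of_real x \<cdot>\<^sub>m (\<beta> \<cdot>\<^sub>m mderiv N ?M x - \<alpha> \<cdot>\<^sub>m mderiv N ?K x)"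
  proof (rule eq_matI, goal_cases)
    case (1 i j)
    note [simp] = smooth_mfunsD[OF coeff_mfun_smooth]
    have ij: "i < N" "j < N" using 1 by simp_all
    have product: "(coeff_mfun N a c \<alpha> p x * coeff_mfun N a d \<beta> q x) $$ (i, j)
      = poly (coeff_entry a c \<alpha> p i i * coeff_entry a d \<beta> q i j
          + (if i = 0 then 0 else coeff_entry a c \<alpha> p i (i - 1) * coeff_entry a d \<beta> q (i - 1) j))
          (complex_of_real x)" for c \<alpha> p d \<beta> q
      using ij by (subst bidiagonal_mult_index[of _ N]) (auto simp: coeff_mfun_def coeff_entry_def)
    show ?case
      using ij
      apply (simp add: product mderiv_coeff_mfun del: index_mult_mat(1) mderiv_index)
      apply (simp add: coeff_mfun_def)
      apply (cases i)
       apply (auto simp: coeff_entry_def pderiv_diff pderiv_pCons poly_monom algebra_simps)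
      done
  qed (simp_all add: smooth_mfunsD[OF coeff_mfun_smooth])
qed

lemma scalar_op_eq_normal_op:
  "scalar_op N (\<lambda>x. poly p (complex_of_real x)) = normal_op N a 0 0 p"
proof -
  have "coeff_mfun N a 0 0 p = scalar_mfun N (\<lambda>x. poly p (complex_of_real x))"
    by (intro ext eq_matI) (auto simp: coeff_mfun_def coeff_entry_def scalar_mfun_def)
  then show ?thesis
    unfolding scalar_op_def normal_op_def
    by (simp add: diffop_eq_first_order_op_0 smooth_mfuns_scalar smooth_poly)
qed

lemma D_op_eq_normal_op: "D_op N a = normal_op N a 0 1 [:0, -1:]"
proof -
  have "coeff_mfun N a 0 1 [:0, -1:] = (\<lambda>x. complex_of_real x \<cdot>\<^sub>m (A_mat N a - 1\<^sub>m N))"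
    by (intro ext eq_matI) (auto simp: coeff_mfun_def coeff_entry_def A_mat_def)
  then show ?thesis
    unfolding D_op_def normal_op_def
    using diffop_eq_first_order_op[OF coeff_mfun_smooth, of N a 0 1 "[:0, -1:]" 1] by simp
qed

definition xphi_poly :: "complex poly \<Rightarrow> nat \<Rightarrow> complex poly" where
  "xphi_poly \<phi> i = monom 1 i * (pderiv ^^ i) \<phi>"

lemma xphi_eq_poly: "xphi \<phi> i = (\<lambda>x. poly (xphi_poly \<phi> i) (complex_of_real x))"
  by (simp add: xphi_def xphi_poly_def poly_monom fun_eq_iff)

lemma Ddag_op_eq_normal_op:
  "Ddag_op N \<nu> \<phi> = normal_op N a 1 (-1) (xphi_poly \<phi> 1 - [:complex_of_real (1 + \<nu>), 1:])"
proof -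
  let ?M = "\<lambda>x. - (complex_of_real (1 + \<nu>) \<cdot>\<^sub>m 1\<^sub>m N + J_mat N)
           + (xphi \<phi> 1 x - complex_of_real x) \<cdot>\<^sub>m 1\<^sub>m N"
  have "coeff_mfun N a 1 (-1) (xphi_poly \<phi> 1 - [:complex_of_real (1 + \<nu>), 1:]) = ?M"
    by (intro ext eq_matI)
       (auto simp: coeff_mfun_def coeff_entry_def J_mat_def xphi_eq_poly algebra_simps)
  then show ?thesis
    unfolding Ddag_op_def normal_op_def
    using diffop_eq_first_order_op[OF coeff_mfun_smooth,
        of N a 1 "-1" "xphi_poly \<phi> 1 - [:complex_of_real (1 + \<nu>), 1:]" "-1"] by simp
qed

section \<open>Constructions of Lie algebras\<close>

lemma lie_algebraI_vectorspace:
  assumes "vectorspace (class_ring :: complex ring) L" "lie_algebra_axioms L"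
  shows "lie_algebra L"
  using assms by (simp add: lie_algebra_def)

text \<open>An injective linear map from a Lie algebra that turns its bracket into a given operation
transports all Lie algebra axioms to its image. Thus the axioms need to be verified only in the
model, not for operators.\<close>

lemma lie_isomorphic_image:
  fixes L :: "('a, 'm) lie_scheme" and M :: "('b, 'n) lie_scheme"
  assumes L: "vectorspace (class_ring :: complex ring) L" and M: "lie_algebra M"
    and T: "T \<in> module_hom (class_ring :: complex ring) M L" and inj: "inj_on T (carrier M)"
    and bracket: "\<And>x y. x \<in> carrier M \<Longrightarrow> y \<in> carrier M \<Longrightarrow>
        T (lie_bracket M x y) = lie_bracket L (T x) (T y)"
  shows "lie_isomorphic (L\<lparr>carrier := T ` carrier M\<rparr>) M"
proof -
  interpret L: vectorspace "class_ring :: complex ring" L by (rule L)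
  interpret M: lie_algebra M by (rule M)
  have hom: "mod_hom class_ring M L T"
    by unfold_locales (rule T)
  let ?I = "L\<lparr>carrier := T ` carrier M\<rparr>"
  have sub: "submodule class_ring (T ` carrier M) L"
    using mod_hom.im_is_submodule[OF hom] by (simp add: mod_hom.im_def[OF hom])
  have vs: "vectorspace class_ring ?I"
    by (rule L.subspace_is_vs) (simp add: subspace_def L sub)
  have smult: "c \<odot>\<^bsub>L\<^esub> T x = T (c \<odot>\<^bsub>M\<^esub> x)" if "x \<in> carrier M" for c x
    using module_hom_smult[OF T, of c x] that by simp
  note T_simps = module_hom_add[OF T, symmetric] smult bracket[symmetric]
    mod_hom.f0_is_0[OF hom, symmetric]
  have lie: "lie_algebra ?I"
  proof (rule lie_algebraI_vectorspace[OF vs], unfold_locales, goal_cases)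
    case (1 x y)
    then show ?case by (auto simp: T_simps M.bracket_closed)
  next
    case (2 x y z)
    then show ?case by (auto simp: T_simps M.bracket_closed M.bracket_add_left)
  next
    case (3 x y z)
    then show ?case by (auto simp: T_simps M.bracket_closed M.bracket_add_right)
  next
    case (4 x y c)
    then show ?case by (auto simp: T_simps M.bracket_closed M.bracket_smult_left)
  next
    case (5 x y c)
    then show ?case by (auto simp: T_simps M.bracket_closed M.bracket_smult_right)
  next
    case (6 x)
    then show ?case by (auto simp: T_simps M.bracket_self)
  next
    case (7 x y z)
    then show ?case by (auto simp: T_simps M.bracket_closed M.jacobi)
  qed
  let ?f = "inv_into (carrier M) T"
  have f_T: "?f (T x) = x" if "x \<in> carrier M" for x
    using inj that by (rule inv_into_f_f)
  have "?f \<in> module_hom class_ring ?I M"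
    by (auto simp: module_hom_def T_simps f_T)
  moreover have "bij_betw ?f (carrier ?I) (carrier M)"
    using inj_on_imp_bij_betw[OF inj] by (simp add: bij_betw_inv_into)
  moreover have "\<forall>x\<in>carrier ?I. \<forall>y\<in>carrier ?I. ?f (lie_bracket ?I x y) = lie_bracket M (?f x) (?f y)"
    by (auto simp: T_simps f_T M.bracket_closed)
  ultimately show ?thesis
    unfolding lie_isomorphic_def using lie M by blast
qed

lemma lie_algebra_direct_sum:
  assumes "lie_algebra L" "lie_algebra M"
  shows "lie_algebra (lie_direct_sum L M)"
proof -
  interpret L: lie_algebra L by fact
  interpret M: lie_algebra M by fact
  have neg: "\<exists>w \<in> carrier V. v \<oplus>\<^bsub>V\<^esub> w = \<zero>\<^bsub>V\<^esub>"
    if "vectorspace (class_ring :: complex ring) V" "v \<in> carrier V" for V :: "('x, 'y) lie_scheme" and v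
  proof -
    interpret V: vectorspace "class_ring :: complex ring" V by fact
    show ?thesis using that(2) V.r_neg by blast
  qed
  have vs: "vectorspace (class_ring :: complex ring) (lie_direct_sum L M)"
  proof (rule vs_criteria[OF class_field])
    show "\<forall>v\<in>carrier (lie_direct_sum L M). \<exists>w\<in>carrier (lie_direct_sum L M).
        v \<oplus>\<^bsub>lie_direct_sum L M\<^esub> w = \<zero>\<^bsub>lie_direct_sum L M\<^esub>"
      using neg[OF L.vectorspace_axioms] neg[OF M.vectorspace_axioms]
      by (fastforce simp: lie_direct_sum_def)
  qed (auto simp: lie_direct_sum_def L.a_ac M.a_ac
      L.smult_assoc1 [simplified] M.smult_assoc1 [simplified]
      L.smult_l_distr [simplified] M.smult_l_distr [simplified]
      L.smult_r_distr M.smult_r_distr L.smult_one [simplified] M.smult_one [simplified])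
  show ?thesis
    by (rule lie_algebraI_vectorspace[OF vs], unfold_locales)
       (auto simp: lie_direct_sum_def L.bracket_closed M.bracket_closed
          L.bracket_add_left M.bracket_add_left L.bracket_add_right M.bracket_add_right
          L.bracket_smult_left M.bracket_smult_left L.bracket_smult_right M.bracket_smult_right
          L.bracket_self M.bracket_self L.jacobi M.jacobi)
qed

lemma vectorspace_carrier_vec:
  assumes "carrier L = carrier_vec n" "zero L = 0\<^sub>v n" "add L = (+)" "module.smult L = (\<cdot>\<^sub>v)"
  shows "vectorspace (class_ring :: complex ring) L"
proof (rule vs_criteria[OF class_field])
  show "\<forall>v\<in>carrier L. \<exists>w\<in>carrier L. v \<oplus>\<^bsub>L\<^esub> w = \<zero>\<^bsub>L\<^esub>"
  proof
    fix v assume "v \<in> carrier L"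
    then show "\<exists>w\<in>carrier L. v \<oplus>\<^bsub>L\<^esub> w = \<zero>\<^bsub>L\<^esub>"
      using assms by (intro bexI[of _ "- v"]) simp_all
  qed
  show "\<forall>v w. v \<in> carrier L \<and> w \<in> carrier L \<longrightarrow> v \<oplus>\<^bsub>L\<^esub> w = w \<oplus>\<^bsub>L\<^esub> v"
    unfolding assms by (intro allI impI comm_add_vec[of _ n]) simp_all
qed (simp_all add: assms smult_smult_assoc add_smult_distrib_vec smult_add_distrib_vec[of _ n]
    assoc_add_vec[of _ n])

lemma lie_algebra_abelian: "lie_algebra (abelian_lie n)"
proof (rule lie_algebraI_vectorspace)
  show "vectorspace (class_ring :: complex ring) (abelian_lie n)"
    by (rule vectorspace_carrier_vec[of _ n]) (auto simp: abelian_lie_def)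
  show "lie_algebra_axioms (abelian_lie n)"
    by unfold_locales (auto simp: abelian_lie_def)
qed

lemma span_zero:
  assumes "vectorspace (class_ring :: complex ring) L" "S \<subseteq> {\<zero>\<^bsub>L\<^esub>}"
  shows "lie_span L S = {\<zero>\<^bsub>L\<^esub>}"
proof -
  interpret L: vectorspace "class_ring :: complex ring" L by fact
  have "submodule class_ring {\<zero>\<^bsub>L\<^esub>} L"
    by (auto simp: submodule_def L.module_axioms)
  then have "L.span S \<subseteq> {\<zero>\<^bsub>L\<^esub>}"
    by (rule L.span_is_subset[OF assms(2)])
  moreover have "\<zero>\<^bsub>L\<^esub> \<in> L.span S"
    using L.span_is_submodule[of S] assms(2) by (auto simp: submodule_def)
  ultimately show ?thesis
    by (auto simp: lie_span_def)
qed

lemma abelian_imp_nilpotent: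
  assumes "vectorspace (class_ring :: complex ring) L" "lie_abelian L"
  shows "lie_nilpotent L"
proof -
  have "lower_central_series L (Suc 0) = {\<zero>\<^bsub>L\<^esub>}"
    using assms(2) unfolding lower_central_series.simps bracket_space_def
    by (intro span_zero[OF assms(1)]) (auto simp: lie_abelian_def)
  then show ?thesis
    unfolding lie_nilpotent_def by blast
qed

section \<open>A derivation acting diagonally on an abelian ideal\<close>

text \<open>The semidirect product of a line with \<open>\<complex>\<^sup>k\<^sup>-\<^sup>1\<close>: the unit vector \<open>0\<close> acts on the unit vector \<open>t\<close>
by the scalar \<open>e t\<close>.\<close>

definition diagonal_lie :: "nat \<Rightarrow> (nat \<Rightarrow> complex) \<Rightarrow> complex vec lie" where
  "diagonal_lie k e = \<lparr>carrier = carrier_vec k, mult = undefined, one = undefined,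
     zero = 0\<^sub>v k, add = (+), smult = (\<cdot>\<^sub>v),
     lie_bracket = (\<lambda>u v. vec k (\<lambda>t. e t * (u $ 0 * v $ t - v $ 0 * u $ t)))\<rparr>"

lemma diagonal_lie_simps [simp]:
  "carrier (diagonal_lie k e) = carrier_vec k"
  "zero (diagonal_lie k e) = 0\<^sub>v k"
  "add (diagonal_lie k e) = (+)"
  "module.smult (diagonal_lie k e) = (\<cdot>\<^sub>v)"
  "lie_bracket (diagonal_lie k e) u v = vec k (\<lambda>t. e t * (u $ 0 * v $ t - v $ 0 * u $ t))"
  by (simp_all add: diagonal_lie_def)

lemma vectorspace_diagonal_lie: "vectorspace (class_ring :: complex ring) (diagonal_lie k e)"
  by (rule vectorspace_carrier_vec[of _ k]) simp_all

lemma lie_algebra_diagonal_lie: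
  assumes "k > 0"
  shows "lie_algebra (diagonal_lie k e)"
proof (rule lie_algebraI_vectorspace[OF vectorspace_diagonal_lie], unfold_locales)
qed (use assms in \<open>auto intro!: eq_vecI simp: algebra_simps\<close>)

lemma lincomb_unit_vecs:
  assumes "I \<subseteq> {..<k}"
  shows "module.lincomb (diagonal_lie k e) c (unit_vec k ` I)
    = vec k (\<lambda>i. if i \<in> I then c (unit_vec k i) else 0)"
proof -
  interpret h: vectorspace "class_ring :: complex ring" "diagonal_lie k e"
    by (rule vectorspace_diagonal_lie)
  interpret V: vec_space "TYPE(complex)" k .
  have unit: "unit_vec k ` I \<subseteq> carrier_vec k" by auto
  have inj: "inj_on (unit_vec k :: nat \<Rightarrow> complex vec) I"
    using assms unit_vec_eq[of _ k] by (fastforce simp: inj_on_def)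
  have fin: "finite I" using assms by (rule finite_subset) simp
  have "h.lincomb c (unit_vec k ` I) = V.lincomb c (unit_vec k ` I)"
    by (simp add: h.lincomb_def V.lincomb_def finsum_def finprod_def module_vec_simps)
  moreover have "V.lincomb c (unit_vec k ` I) $ i = (if i \<in> I then c (unit_vec k i) else 0)"
    if "i < k" for i
  proof -
    have "V.lincomb c (unit_vec k ` I) $ i = (\<Sum>j\<in>I. c (unit_vec k j) * unit_vec k j $ i)"
      by (simp add: V.lincomb_index[OF that unit] sum.reindex[OF inj])
    also have "\<dots> = (\<Sum>j\<in>I. if i = j then c (unit_vec k j) else 0)"
      using assms that by (intro sum.cong) auto
    finally show ?thesis using fin by simp
  qed
  moreover have "V.lincomb c (unit_vec k ` I) \<in> carrier_vec k"
    using V.lincomb_closed[OF unit] by simp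
  ultimately show ?thesis
    by (intro eq_vecI) auto
qed

text \<open>All subspaces of the model that are of interest are coordinate subspaces, so that membership
in a span becomes a condition on coordinates.\<close>

lemma span_unit_vecs:
  assumes "I \<subseteq> {..<k}"
  shows "lie_span (diagonal_lie k e) (unit_vec k ` I)
    = {v \<in> carrier_vec k. \<forall>i<k. i \<notin> I \<longrightarrow> v $ i = 0}"
proof -
  interpret h: vectorspace "class_ring :: complex ring" "diagonal_lie k e"
    by (rule vectorspace_diagonal_lie)
  have fin: "finite (unit_vec k ` I)" using assms finite_subset by blast
  have "h.span (unit_vec k ` I) = {vec k (\<lambda>i. if i \<in> I then c (unit_vec k i) else 0) |c :: complex vec \<Rightarrow> complex. True}"
    by (subst h.finite_span[OF fin]) (auto simp: lincomb_unit_vecs[OF assms])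
  also have "\<dots> = {v \<in> carrier_vec k. \<forall>i<k. i \<notin> I \<longrightarrow> v $ i = 0}"
  proof (intro equalityI subsetI)
    fix v :: "complex vec" assume v: "v \<in> {v \<in> carrier_vec k. \<forall>i<k. i \<notin> I \<longrightarrow> v $ i = 0}"
    have "v = vec k (\<lambda>i. if i \<in> I then (\<lambda>u. u \<bullet> v) (unit_vec k i) else 0)"
      using v assms by (intro eq_vecI) (auto simp: scalar_prod_left_unit)
    then show "v \<in> {vec k (\<lambda>i. if i \<in> I then c (unit_vec k i) else 0) |c :: complex vec \<Rightarrow> complex. True}"
      by (intro CollectI exI[of _ "\<lambda>u. u \<bullet> v"]) blast
  qed auto
  finally show ?thesis by (simp add: lie_span_def)
qed

lemma lin_indpt_unit_vecs:
  assumes "I \<subseteq> {..<k}"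
  shows "\<not> module.lin_dep (class_ring :: complex ring) (diagonal_lie k e) (unit_vec k ` I)"
proof -
  interpret h: vectorspace "class_ring :: complex ring" "diagonal_lie k e"
    by (rule vectorspace_diagonal_lie)
  show ?thesis
  proof (rule h.finite_lin_indpt2)
    show "finite (unit_vec k ` I)" using assms finite_subset by blast
    fix c assume "h.lincomb c (unit_vec k ` I) = \<zero>\<^bsub>diagonal_lie k e\<^esub>"
    then have "vec k (\<lambda>i. if i \<in> I then c (unit_vec k i) else 0) = 0\<^sub>v k"
      by (simp add: lincomb_unit_vecs[OF assms])
    then have "c (unit_vec k i) = 0" if "i \<in> I" for i
      using that assms by (auto dest!: arg_cong[where f = "\<lambda>v. v $ i"])
    then show "\<forall>v\<in>unit_vec k ` I. c v = \<zero>\<^bsub>class_ring\<^esub>" by auto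
  qed auto
qed

lemma basis_unit_vecs:
  "vectorspace.basis (class_ring :: complex ring) (diagonal_lie k e) (unit_vec k ` {..<k})"
proof -
  interpret h: vectorspace "class_ring :: complex ring" "diagonal_lie k e"
    by (rule vectorspace_diagonal_lie)
  have "{v \<in> carrier_vec k. \<forall>i<k. i \<notin> {..<k} \<longrightarrow> v $ i = (0 :: complex)} = carrier_vec k"
    by auto
  then have "h.span (unit_vec k ` {..<k}) = carrier_vec k"
    using span_unit_vecs[of "{..<k}" k e] by (simp add: lie_span_def)
  moreover have "unit_vec k ` {..<k} \<subseteq> carrier_vec k"
    by (rule image_subsetI) (rule unit_vec_carrier)
  ultimately show ?thesis
    using lin_indpt_unit_vecs[of "{..<k}" k e] by (simp add: h.basis_def)
qed

lemma lie_has_dim_coordinate_subspace: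
  assumes "I \<subseteq> {..<k}"
  defines "R \<equiv> {v \<in> carrier_vec k. \<forall>i<k. i \<notin> I \<longrightarrow> v $ i = (0 :: complex)}"
  shows "lie_has_dim ((diagonal_lie k e)\<lparr>carrier := R\<rparr>) (card I)"
proof -
  interpret h: vectorspace "class_ring :: complex ring" "diagonal_lie k e"
    by (rule vectorspace_diagonal_lie)
  let ?B = "unit_vec k ` I :: complex vec set" and ?R = "(diagonal_lie k e)\<lparr>carrier := R\<rparr>"
  have R: "h.span ?B = R"
    using span_unit_vecs[OF assms(1)] by (simp add: R_def lie_span_def)
  have B: "?B \<subseteq> carrier (diagonal_lie k e)" by auto
  have sub: "submodule class_ring R (diagonal_lie k e)"
    using h.span_is_submodule[OF B] by (simp add: R)
  have BR: "?B \<subseteq> R" using h.in_own_span[OF B] by (simp add: R)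
  interpret R: vectorspace "class_ring :: complex ring" ?R
    by (rule h.subspace_is_vs) (simp add: subspace_def sub vectorspace_diagonal_lie)
  have fin: "finite ?B" using assms finite_subset by blast
  have span: "R.span ?B = carrier ?R"
    using h.span_li_not_depend(1)[OF BR sub] by (simp add: R)
  have "R.basis ?B"
    using span BR h.span_li_not_depend(2)[OF BR sub] lin_indpt_unit_vecs[OF assms(1)]
    by (simp add: R.basis_def)
  moreover have "card ?B = card I"
    using assms unit_vec_eq[of _ k] by (intro card_image) (fastforce simp: inj_on_def)
  ultimately have "R.dim = card I"
    using R.dim_basis[OF fin] by simp
  moreover have "R.fin_dim"
    unfolding R.fin_dim_def using fin span BR by (intro exI[of _ ?B]) simp
  ultimately show ?thesis
    by (simp add: lie_has_dim_def)
qed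

text \<open>The abelian ideal spanned by the eigenvectors, as a hyperplane.\<close>

definition zero_first :: "nat \<Rightarrow> complex vec set" where
  "zero_first k = {v \<in> carrier_vec k. v $ 0 = 0}"

lemma zero_first_eq:
  assumes "k > 0"
  shows "zero_first k = {v \<in> carrier_vec k. \<forall>i<k. i \<notin> {1..k - 1} \<longrightarrow> v $ i = 0}"
proof -
  have "i \<notin> {1..k - 1} \<longleftrightarrow> i = 0" if "i < k" for i
    using that by auto
  then show ?thesis
    using assms by (auto simp: zero_first_def)
qed

lemma span_unit_vecs_pos:
  assumes "k > 0"
  shows "lie_span (diagonal_lie k e) (unit_vec k ` {1..k - 1}) = zero_first k"
proof -
  have "{1..k - 1} \<subseteq> {..<k}" using assms by auto
  then show ?thesis unfolding zero_first_eq[OF assms] by (rule span_unit_vecs)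
qed

lemma lie_ideal_zero_first:
  assumes "k > 0"
  shows "lie_ideal (zero_first k) (diagonal_lie k e)"
  unfolding lie_ideal_def subspace_def submodule_def
proof (intro conjI)
  show "vectorspace (class_ring :: complex ring) (diagonal_lie k e)"
    by (rule vectorspace_diagonal_lie)
  then show "module (class_ring :: complex ring) (diagonal_lie k e)"
    by (simp add: vectorspace_def)
qed (use assms in \<open>auto simp: zero_first_def\<close>)

lemma lie_abelian_zero_first: "lie_abelian ((diagonal_lie k e)\<lparr>carrier := zero_first k\<rparr>)"
  by (auto simp: lie_abelian_def zero_first_def)

lemma vectorspace_lie_ideal:
  assumes "lie_ideal I L"
  shows "vectorspace (class_ring :: complex ring) (L\<lparr>carrier := I\<rparr>)"
proof -
  interpret L: vectorspace "class_ring :: complex ring" L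
    using assms by (simp add: lie_ideal_def subspace_def)
  show ?thesis
    using assms by (intro L.subspace_is_vs) (simp add: lie_ideal_def)
qed

text \<open>Brackets have vanishing coordinate \<open>0\<close>, so the derived algebra lies in the abelian
hyperplane.\<close>

lemma lie_solvable_diagonal_lie:
  assumes "k > 0"
  shows "lie_solvable (diagonal_lie k e)"
proof -
  let ?h = "diagonal_lie k e"
  interpret h: vectorspace "class_ring :: complex ring" ?h
    by (rule vectorspace_diagonal_lie)
  have "submodule class_ring (zero_first k) ?h"
    using lie_ideal_zero_first[OF assms, of e] by (simp add: lie_ideal_def subspace_def)
  then have "derived_series ?h 1 \<subseteq> zero_first k"
    using assms unfolding One_nat_def derived_series.simps bracket_space_def lie_span_def
    by (intro h.span_is_subset) (auto simp: zero_first_def)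
  then have "{lie_bracket ?h x y | x y. x \<in> derived_series ?h 1 \<and> y \<in> derived_series ?h 1} \<subseteq> {\<zero>\<^bsub>?h\<^esub>}"
    using lie_abelian_zero_first[of k e] by (auto simp: lie_abelian_def)
  then have "derived_series ?h (Suc 1) = {\<zero>\<^bsub>?h\<^esub>}"
    unfolding derived_series.simps bracket_space_def by (rule span_zero[OF vectorspace_diagonal_lie])
  then show ?thesis
    unfolding lie_solvable_def by blast
qed

text \<open>Suppose that \<open>I\<close> contains \<open>u\<close> with \<open>u\<^sub>0 \<noteq> 0\<close>, and let \<open>w\<close> be the unit vector \<open>t\<close>. A multiple \<open>v\<close> of
\<open>u\<close> satisfies \<open>[v, w] = w\<close>. Since \<open>I\<close> is an ideal, \<open>w\<close> lies in \<open>I\<close>, and then it lies in every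
term of the lower central series of \<open>I\<close>.\<close>

lemma nilpotent_ideal_subset_zero_first:
  assumes t: "0 < t" "t < k" "e t \<noteq> 0"
    and I: "lie_ideal I (diagonal_lie k e)" and nil: "lie_nilpotent ((diagonal_lie k e)\<lparr>carrier := I\<rparr>)"
  shows "I \<subseteq> zero_first k"
proof (rule ccontr)
  let ?h = "diagonal_lie k e" and ?w = "unit_vec k t :: complex vec"
  let ?I = "?h\<lparr>carrier := I\<rparr>"
  interpret I: vectorspace "class_ring :: complex ring" ?I
    by (rule vectorspace_lie_ideal[OF I])
  have sub: "submodule class_ring I ?h"
    using I by (simp add: lie_ideal_def subspace_def)
  have I_carrier: "I \<subseteq> carrier_vec k"
    using submodule.subset[OF sub] by simp
  have I_smult: "c \<cdot>\<^sub>v v \<in> I" if "v \<in> I" for c v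
    using submodule.smult_closed[OF sub, of c v] that by simp
  have I_bracket: "lie_bracket ?h x y \<in> I" if "x \<in> carrier_vec k" "y \<in> I" for x y
    using I that unfolding lie_ideal_def by simp
  assume "\<not> I \<subseteq> zero_first k"
  then obtain u where u: "u \<in> I" "u $ 0 \<noteq> 0"
    using I_carrier by (auto simp: zero_first_def)
  have dim_u: "dim_vec u = k" using u I_carrier by auto
  \<comment> \<open>Scaled so that \<open>v\<close> acts on the unit vector \<open>t\<close> as the identity.\<close>
  define v where "v = inverse (u $ 0 * e t) \<cdot>\<^sub>v u"
  have v: "v \<in> I" unfolding v_def using u(1) by (rule I_smult)
  have v0: "v $ 0 * e t = 1"
    using u(2) t dim_u by (simp add: v_def field_simps)
  have bracket_vw: "lie_bracket ?h v ?w = ?w"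
  proof (rule eq_vecI)
    fix i assume "i < dim_vec ?w"
    then show "lie_bracket ?h v ?w $ i = ?w $ i"
      using t v0 by (cases "i = t") (simp_all add: mult.commute)
  qed simp
  have "(- 1) \<cdot>\<^sub>v lie_bracket ?h ?w v = lie_bracket ?h v ?w"
    by (rule eq_vecI) (simp_all add: algebra_simps)
  then have w: "?w \<in> I"
    using I_smult[OF I_bracket[OF unit_vec_carrier v], of "-1" t] bracket_vw by simp
  have "?w \<in> lower_central_series ?I m \<and> lower_central_series ?I m \<subseteq> I" for m
  proof (induction m)
    case 0
    show ?case using w by simp
  next
    case (Suc m)
    let ?S = "{lie_bracket ?I x y |x y. x \<in> I \<and> y \<in> lower_central_series ?I m}"
    have S: "?S \<subseteq> carrier ?I"
      using Suc I_bracket I_carrier by auto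
    moreover have "?w \<in> ?S"
    proof (intro CollectI exI conjI)
      show "?w = lie_bracket ?I v ?w" using bracket_vw by simp
      show "v \<in> I" by (rule v)
      show "?w \<in> lower_central_series ?I m" using Suc by blast
    qed
    ultimately have "?w \<in> I.span ?S" "I.span ?S \<subseteq> I"
      using I.in_own_span[OF S] I.span_is_subset2[OF S] by auto
    then show ?case
      by (simp add: bracket_space_def lie_span_def)
  qed
  then have "?w = \<zero>\<^bsub>?I\<^esub>"
    using nil unfolding lie_nilpotent_def by blast
  then have "?w $ t = 0\<^sub>v k $ t" by simp
  then show False using t by simp
qed

lemma is_nilradical_zero_first:
  assumes "0 < t" "t < k" "e t \<noteq> 0"
  shows "is_nilradical (zero_first k) (diagonal_lie k e)"
proof -
  have "lie_ideal (zero_first k) (diagonal_lie k e)"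
    by (rule lie_ideal_zero_first) (use assms in simp)
  moreover have "lie_nilpotent ((diagonal_lie k e)\<lparr>carrier := zero_first k\<rparr>)"
    by (rule abelian_imp_nilpotent[OF vectorspace_lie_ideal lie_abelian_zero_first]) fact
  ultimately show ?thesis
    unfolding is_nilradical_def using nilpotent_ideal_subset_zero_first[where e = e, OF assms] by blast
qed

lemma span_unit_vec_0:
  assumes "k > 0"
  shows "lie_span (diagonal_lie k e) {unit_vec k 0} = {c \<cdot>\<^sub>v unit_vec k 0 |c. True}"
proof -
  have "v = v $ 0 \<cdot>\<^sub>v unit_vec k 0"
    if "v \<in> carrier_vec k" "\<forall>i<k. i \<notin> {0} \<longrightarrow> v $ i = 0" for v :: "complex vec"
    using that assms by (intro eq_vecI) auto
  then show ?thesis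
    using span_unit_vecs[of "{0}" k e] assms by auto
qed

lemma lie_semidirect_diagonal_lie:
  assumes "k > 0"
  shows "lie_semidirect (diagonal_lie k e) (lie_span (diagonal_lie k e) {unit_vec k 0}) (zero_first k)"
  unfolding lie_semidirect_def
proof (intro conjI)
  let ?h = "diagonal_lie k e" and ?S = "{c \<cdot>\<^sub>v unit_vec k 0 |c :: complex. True}"
  interpret h: vectorspace "class_ring :: complex ring" ?h
    by (rule vectorspace_diagonal_lie)
  have S: "lie_span ?h {unit_vec k 0} = ?S" by (rule span_unit_vec_0[OF assms])
  have "submodule class_ring (lie_span ?h {unit_vec k 0}) ?h"
    unfolding lie_span_def by (rule h.span_is_submodule) simp
  moreover have "lie_bracket ?h x y = 0 \<cdot>\<^sub>v unit_vec k 0" if "x \<in> ?S" "y \<in> ?S" for x y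
    using that assms by (intro eq_vecI) auto
  ultimately show "lie_subalgebra (lie_span ?h {unit_vec k 0}) ?h"
    unfolding lie_subalgebra_def subspace_def S using vectorspace_diagonal_lie by blast
  show "lie_ideal (zero_first k) ?h" by (rule lie_ideal_zero_first[OF assms])
  show "lie_span ?h {unit_vec k 0} \<inter> zero_first k = {\<zero>\<^bsub>?h\<^esub>}"
  proof -
    have "0\<^sub>v k = (0 :: complex) \<cdot>\<^sub>v unit_vec k 0" by (rule eq_vecI) simp_all
    moreover have "c \<cdot>\<^sub>v unit_vec k 0 = 0\<^sub>v k" if "(c \<cdot>\<^sub>v unit_vec k 0) $ 0 = (0 :: complex)" for c
      using that assms by (intro eq_vecI) auto
    ultimately have "x \<in> ?S \<inter> zero_first k \<longleftrightarrow> x = 0\<^sub>v k" for x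
      using assms by (force simp: zero_first_def)
    then show ?thesis
      unfolding S by auto
  qed
  show "{s \<oplus>\<^bsub>?h\<^esub> i |s i. s \<in> lie_span ?h {unit_vec k 0} \<and> i \<in> zero_first k} = carrier ?h"
    unfolding S
  proof (intro equalityI subsetI)
    fix v assume "v \<in> carrier ?h"
    then have v: "v \<in> carrier_vec k" by simp
    let ?i = "vec k (\<lambda>t. if t = 0 then 0 else v $ t)"
    have "v = (v $ 0 \<cdot>\<^sub>v unit_vec k 0) + ?i"
      using v by (intro eq_vecI) auto
    moreover have "?i \<in> zero_first k" using assms by (simp add: zero_first_def)
    ultimately show "v \<in> {s \<oplus>\<^bsub>?h\<^esub> i |s i. s \<in> ?S \<and> i \<in> zero_first k}"
      unfolding diagonal_lie_simps by blast
  qed (auto simp: zero_first_def)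
qed

lemma lie_has_dim_zero_first:
  assumes "k > 0"
  shows "lie_has_dim ((diagonal_lie k e)\<lparr>carrier := zero_first k\<rparr>) (k - 1)"
proof -
  have "{1..k - 1} \<subseteq> {..<k}" using assms by auto
  from lie_has_dim_coordinate_subspace[OF this, of e] show ?thesis
    unfolding zero_first_eq[OF assms] by simp
qed

lemma lie_has_dim_diagonal_lie: "lie_has_dim (diagonal_lie k e) k"
proof -
  interpret h: vectorspace "class_ring :: complex ring" "diagonal_lie k e"
    by (rule vectorspace_diagonal_lie)
  let ?B = "unit_vec k ` {..<k} :: complex vec set"
  have basis: "h.basis ?B" by (rule basis_unit_vecs)
  have "card ?B = k"
    using unit_vec_eq[of _ k] by (subst card_image) (fastforce simp: inj_on_def)+
  then show ?thesis
    using h.dim_basis[OF _ basis] basis unfolding lie_has_dim_def h.fin_dim_def h.basis_def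
    by (auto intro!: exI[of _ ?B])
qed

section \<open>The operators in the Lie algebra of a polynomial\<close>

lemma coeff_xphi_poly_0: "coeff (xphi_poly \<phi> 0) j = coeff \<phi> j"
  by (simp add: xphi_poly_def)

text \<open>The recursion of the falling factorials: \<open>x\<^sup>i\<^sup>+\<^sup>1 \<phi>\<^sup>(\<^sup>i\<^sup>+\<^sup>1\<^sup>)\<close> is obtained from \<open>x\<^sup>i \<phi>\<^sup>(\<^sup>i\<^sup>)\<close> by the operator
\<open>x \<partial>\<^sub>x - i\<close>, which multiplies the coefficient of \<open>x\<^sup>j\<close> by \<open>j - i\<close>.\<close>

lemma coeff_xphi_poly_Suc:
  "coeff (xphi_poly \<phi> (Suc i)) j = (of_nat j - of_nat i) * coeff (xphi_poly \<phi> i) j"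
proof (cases "i < j")
  case True
  then have "j - i = Suc (j - Suc i)" by simp
  then show ?thesis
    using True by (simp add: xphi_poly_def coeff_monom_mult coeff_pderiv of_nat_diff)
next
  case False
  then show ?thesis
    by (cases "i = j") (simp_all add: xphi_poly_def coeff_monom_mult)
qed

text \<open>Multiplying the coefficients by \<open>j - c\<close> stays inside the span, because
\<open>j - c = (j - i) + (i - c)\<close> and multiplication by \<open>j - i\<close> only raises \<open>i\<close>. It is for this that
the induction hypothesis is needed for all \<open>i\<close>.\<close>

lemma xphi_poly_span_interpolation:
  assumes add: "\<And>p q. p \<in> W \<Longrightarrow> q \<in> W \<Longrightarrow> p + q \<in> W"
    and smult: "\<And>c p. p \<in> W \<Longrightarrow> Polynomial.smult c p \<in> W"
    and xphi: "\<And>i. i \<ge> 1 \<Longrightarrow> xphi_poly \<phi> i \<in> W"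
    and "finite C" "i \<ge> 1"
  shows "\<exists>p\<in>W. \<forall>j. coeff p j = coeff (xphi_poly \<phi> i) j * (\<Prod>c\<in>C. of_nat j - of_nat c)"
  using assms(4,5)
proof (induction C arbitrary: i rule: finite_induct)
  case empty
  then show ?case using xphi by auto
next
  case (insert c C)
  obtain p where p: "p \<in> W"
    "\<And>j. coeff p j = coeff (xphi_poly \<phi> (Suc i)) j * (\<Prod>c\<in>C. of_nat j - of_nat c)"
    using insert.IH[of "Suc i"] by auto
  obtain q where q: "q \<in> W"
    "\<And>j. coeff q j = coeff (xphi_poly \<phi> i) j * (\<Prod>c\<in>C. of_nat j - of_nat c)"
    using insert.IH[OF insert.prems] by auto
  have "coeff (p + Polynomial.smult (of_nat i - of_nat c) q) j
      = coeff (xphi_poly \<phi> i) j * (\<Prod>c\<in>insert c C. of_nat j - of_nat c)" for j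
    using insert.hyps by (simp add: p(2) q(2) coeff_xphi_poly_Suc algebra_simps)
  then show ?case
    using add[OF p(1) smult[OF q(1)]] by blast
qed

text \<open>Interpolation at the exponents up to the degree: the factors \<open>j - c\<close> for all \<open>c\<close> other than the
chosen exponent annihilate every other term.\<close>

lemma monom_in_xphi_poly_span:
  assumes add: "\<And>p q. p \<in> W \<Longrightarrow> q \<in> W \<Longrightarrow> p + q \<in> W"
    and smult: "\<And>c p. p \<in> W \<Longrightarrow> Polynomial.smult c p \<in> W"
    and xphi: "\<And>i. i \<ge> 1 \<Longrightarrow> xphi_poly \<phi> i \<in> W"
    and j: "j \<ge> 1" "coeff \<phi> j \<noteq> 0"
  shows "monom c j \<in> W"
proof -
  obtain p where p: "p \<in> W" "\<And>m. coeff p m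
      = coeff (xphi_poly \<phi> 1) m * (\<Prod>c\<in>{..degree \<phi>} - {j}. of_nat m - of_nat c)"
    using xphi_poly_span_interpolation[OF add smult xphi, of "{..degree \<phi>} - {j}" 1] by auto
  have coeff_p: "coeff p m = of_nat m * coeff \<phi> m * (\<Prod>c\<in>{..degree \<phi>} - {j}. of_nat m - of_nat c)" for m
    using coeff_xphi_poly_Suc[of \<phi> 0 m] by (simp add: p(2) coeff_xphi_poly_0)
  have other: "coeff p m = 0" if "m \<noteq> j" for m
    using that coeff_eq_0[of \<phi> m] by (cases "m \<le> degree \<phi>") (auto simp: coeff_p)
  have nonzero: "coeff p j \<noteq> 0"
    using j by (auto simp: coeff_p)
  have "monom c j = Polynomial.smult (c / coeff p j) p"
    using other nonzero by (intro poly_eqI) auto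
  then show ?thesis
    using smult[OF p(1)] by simp
qed

text \<open>The scalar polynomials that occur in the Lie algebra: \<open>1\<close> and \<open>x\<close> are generators of their own,
the other exponents come from \<open>\<phi>\<close>.\<close>

definition support_poly :: "complex poly \<Rightarrow> complex poly set" where
  "support_poly \<phi> = {p. \<forall>i. coeff p i \<noteq> 0 \<longrightarrow> i = 0 \<or> i = 1 \<or> coeff \<phi> i \<noteq> 0}"

lemma support_poly_subset:
  assumes zero: "0 \<in> W"
    and add: "\<And>p q. p \<in> W \<Longrightarrow> q \<in> W \<Longrightarrow> p + q \<in> W"
    and smult: "\<And>c p. p \<in> W \<Longrightarrow> Polynomial.smult c p \<in> W"
    and gens: "1 \<in> W" "[:0, 1:] \<in> W"
    and xphi: "\<And>i. i \<ge> 1 \<Longrightarrow> xphi_poly \<phi> i \<in> W"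
  shows "support_poly \<phi> \<subseteq> W"
proof
  fix p assume p: "p \<in> support_poly \<phi>"
  have "monom (coeff p i) i \<in> W" for i
  proof -
    consider "coeff p i = 0" | "i = 0" | "i = 1" | "i \<ge> 1" "coeff \<phi> i \<noteq> 0"
      using p by (fastforce simp: support_poly_def)
    then show ?thesis
    proof cases
      case 1
      then show ?thesis using zero by simp
    next
      case 2
      then show ?thesis using smult[OF gens(1), of "coeff p i"] by (simp add: monom_0)
    next
      case 3
      then show ?thesis using smult[OF gens(2), of "coeff p i"] by (simp add: monom_altdef)
    next
      case 4
      then show ?thesis by (intro monom_in_xphi_poly_span[of W, OF add smult xphi])
    qed
  qed
  then have "(\<Sum>i\<le>m. monom (coeff p i) i) \<in> W" for m
    by (induction m) (simp_all add: add)
  from this[of "degree p"] have "(\<Sum>i\<le>degree p. monom (coeff p i) i) \<in> W" .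
  then show "p \<in> W"
    by (simp add: poly_as_sum_of_monoms)
qed

definition g_gens :: "nat \<Rightarrow> real \<Rightarrow> (nat \<Rightarrow> real) \<Rightarrow> complex poly \<Rightarrow> operator set" where
  "g_gens N \<nu> a \<phi> =
     {scalar_op N (\<lambda>x. 1), D_op N a, Ddag_op N \<nu> \<phi>, scalar_op N complex_of_real}
       \<union> {scalar_op N (xphi \<phi> i) | i. i \<ge> 1}"

definition normal_ops :: "nat \<Rightarrow> (nat \<Rightarrow> real) \<Rightarrow> complex poly \<Rightarrow> operator set" where
  "normal_ops N a \<phi> = {normal_op N a c \<alpha> p | c \<alpha> p. p \<in> support_poly \<phi>}"

lemma g_gens_eq:
  "g_gens N \<nu> a \<phi> =
     {normal_op N a 0 0 1, normal_op N a 0 1 [:0, -1:],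
      normal_op N a 1 (-1) (xphi_poly \<phi> 1 - [:complex_of_real (1 + \<nu>), 1:]),
      normal_op N a 0 0 [:0, 1:]}
       \<union> {normal_op N a 0 0 (xphi_poly \<phi> i) | i. i \<ge> 1}"
  unfolding g_gens_def xphi_eq_poly D_op_eq_normal_op Ddag_op_eq_normal_op[of N \<nu> \<phi> a]
  using scalar_op_eq_normal_op[of N 1 a] scalar_op_eq_normal_op[of N "[:0, 1:]" a]
    scalar_op_eq_normal_op[of N _ a]
  by simp

lemma coeff_xphi_poly_eq_0:
  assumes "coeff \<phi> j = 0"
  shows "coeff (xphi_poly \<phi> i) j = 0"
  by (induction i) (simp_all add: coeff_xphi_poly_0 coeff_xphi_poly_Suc assms)

lemma xphi_poly_support: "xphi_poly \<phi> i \<in> support_poly \<phi>"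
  using coeff_xphi_poly_eq_0 unfolding support_poly_def by blast

lemma support_poly_add:
  assumes "p \<in> support_poly \<phi>" "q \<in> support_poly \<phi>"
  shows "p + q \<in> support_poly \<phi>"
proof -
  have "coeff p i \<noteq> 0 \<or> coeff q i \<noteq> 0" if "coeff (p + q) i \<noteq> 0" for i
    using that by auto
  then show ?thesis
    using assms unfolding support_poly_def by blast
qed

lemma support_poly_smult: "p \<in> support_poly \<phi> \<Longrightarrow> Polynomial.smult c p \<in> support_poly \<phi>"
  by (auto simp: support_poly_def)

lemma support_poly_linear: "[:c, d:] \<in> support_poly \<phi>"
  by (auto simp: support_poly_def coeff_pCons split: nat.splits)

lemma xphi_poly_minus_linear_support: "xphi_poly \<phi> i - [:c, d:] \<in> support_poly \<phi>"
proof -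
  have "xphi_poly \<phi> i - [:c, d:] = xphi_poly \<phi> i + [:- c, - d:]"
    by (rule poly_eqI) (simp add: coeff_pCons split: nat.split)
  then show ?thesis
    using support_poly_add[OF xphi_poly_support support_poly_linear] by metis
qed

text \<open>The generators have normal form with \<open>p\<close> in \<open>support_poly \<phi>\<close>. Conversely all such scalar
operators are in the span, and modulo these \<open>\<D>\<close> and \<open>\<D>\<dagger>\<close> are \<open>(0, 1, 0)\<close> and \<open>(1, -1, 0)\<close>, which
generate all pairs \<open>(c, \<alpha>)\<close>.\<close>

lemma g_phi_carrier: "carrier (g_phi N \<nu> a \<phi>) = normal_ops N a \<phi>"
proof -
  let ?L = "diffop_lie N"
  interpret L: vectorspace "class_ring :: complex ring" ?L
    by (rule vectorspace_diffop_lie)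
  let ?S = "g_gens N \<nu> a \<phi>"
  have sub: "submodule class_ring (normal_ops N a \<phi>) ?L"
  proof (unfold submodule_def, intro conjI allI impI)
    show "module (class_ring :: complex ring) ?L" by (rule L.module_axioms)
    show "normal_ops N a \<phi> \<subseteq> carrier ?L"
      by (auto simp: normal_ops_def normal_op_carrier)
    show "\<zero>\<^bsub>?L\<^esub> \<in> normal_ops N a \<phi>"
      using support_poly_linear[of 0 0] unfolding normal_op_zero[of N a, symmetric] normal_ops_def
      by auto
    show "v \<oplus>\<^bsub>?L\<^esub> w \<in> normal_ops N a \<phi>" if "v \<in> normal_ops N a \<phi>" "w \<in> normal_ops N a \<phi>" for v w
      using that unfolding normal_ops_def
      by (auto simp only: normal_op_add mem_Collect_eq) (blast intro: support_poly_add)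
    show "c \<odot>\<^bsub>?L\<^esub> v \<in> normal_ops N a \<phi>" if "v \<in> normal_ops N a \<phi>" for c v
      using that unfolding normal_ops_def
      by (auto simp only: normal_op_smult mem_Collect_eq) (blast intro: support_poly_smult)
  qed
  have gens: "?S \<subseteq> normal_ops N a \<phi>"
  proof -
    have "1 \<in> support_poly \<phi>"
      using support_poly_linear[of 1 0] by (simp add: one_pCons)
    then show ?thesis
      unfolding g_gens_eq normal_ops_def
      using support_poly_linear xphi_poly_support xphi_poly_minus_linear_support by blast
  qed
  have S_carrier: "?S \<subseteq> carrier ?L"
    using gens submodule.subset[OF sub] by blast
  have span: "submodule class_ring (L.span ?S) ?L"
    by (rule L.span_is_submodule[OF S_carrier])
  note in_span = L.in_own_span[OF S_carrier, THEN subsetD]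
  note span_add = submodule.m_closed[OF span]
  have span_smult: "c \<odot>\<^bsub>?L\<^esub> v \<in> L.span ?S" if "v \<in> L.span ?S" for c v
    using submodule.smult_closed[OF span, of c v] that by simp
  have scalar: "support_poly \<phi> \<subseteq> {p. normal_op N a 0 0 p \<in> L.span ?S}"
  proof (rule support_poly_subset; unfold mem_Collect_eq)
    show "normal_op N a 0 0 0 \<in> L.span ?S"
      unfolding normal_op_zero by (rule submodule.zero_closed[OF span])
    show "normal_op N a 0 0 (p + q) \<in> L.span ?S"
      if "normal_op N a 0 0 p \<in> L.span ?S" "normal_op N a 0 0 q \<in> L.span ?S" for p q
      using span_add[OF that] unfolding normal_op_add by simp
    show "normal_op N a 0 0 (Polynomial.smult c p) \<in> L.span ?S"
      if "normal_op N a 0 0 p \<in> L.span ?S" for c p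
      using span_smult[OF that, of c] unfolding normal_op_smult by simp
    show "normal_op N a 0 0 1 \<in> L.span ?S"
      by (rule in_span) (simp add: g_gens_eq)
    show "normal_op N a 0 0 [:0, 1:] \<in> L.span ?S"
      by (rule in_span) (simp add: g_gens_eq)
    show "normal_op N a 0 0 (xphi_poly \<phi> i) \<in> L.span ?S" if "i \<ge> 1" for i
      by (rule in_span) (use that in \<open>auto simp: g_gens_eq\<close>)
  qed
  have "normal_op N a c \<alpha> p \<in> L.span ?S" if p: "p \<in> support_poly \<phi>" for c \<alpha> p
  proof -
    let ?r = "xphi_poly \<phi> 1 - [:complex_of_real (1 + \<nu>), 1:]"
    \<comment> \<open>The scalar part that is left when the scalar parts of \<open>(c + \<alpha>) \<D>\<close> and \<open>c \<D>\<dagger>\<close> are removed.\<close>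
    let ?q = "p + Polynomial.smult (- (c + \<alpha>)) [:0, -1:] + Polynomial.smult (- c) ?r"
    have "?q \<in> support_poly \<phi>"
      by (intro support_poly_add support_poly_smult support_poly_linear xphi_poly_minus_linear_support p)
    then have "normal_op N a 0 0 ?q \<in> L.span ?S"
      using scalar by blast
    moreover have "normal_op N a 0 1 [:0, -1:] \<in> L.span ?S" "normal_op N a 1 (-1) ?r \<in> L.span ?S"
      by (rule in_span, simp add: g_gens_eq)+
    ultimately have "normal_op N a 0 0 ?q \<oplus>\<^bsub>?L\<^esub> ((c + \<alpha>) \<odot>\<^bsub>?L\<^esub> normal_op N a 0 1 [:0, -1:]
        \<oplus>\<^bsub>?L\<^esub> c \<odot>\<^bsub>?L\<^esub> normal_op N a 1 (-1) ?r) \<in> L.span ?S"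
      by (intro span_add span_smult)
    moreover have "p + Polynomial.smult (- s) g + Polynomial.smult (- c) r
        + (Polynomial.smult s g + Polynomial.smult c r) = p" for s g r
      by (simp add: algebra_simps)
    then have "normal_op N a 0 0 ?q \<oplus>\<^bsub>?L\<^esub> ((c + \<alpha>) \<odot>\<^bsub>?L\<^esub> normal_op N a 0 1 [:0, -1:]
        \<oplus>\<^bsub>?L\<^esub> c \<odot>\<^bsub>?L\<^esub> normal_op N a 1 (-1) ?r) = normal_op N a c \<alpha> p"
      unfolding normal_op_add normal_op_smult by (simp only:) simp
    ultimately show ?thesis by simp
  qed
  then have "normal_ops N a \<phi> \<subseteq> L.span ?S"
    by (auto simp: normal_ops_def)
  moreover have "L.span ?S \<subseteq> normal_ops N a \<phi>"
    by (rule L.span_is_subset[OF gens sub])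
  ultimately show ?thesis
    by (simp add: g_phi_def g_gens_def lie_span_def)
qed

section \<open>The isomorphism with the diagonal model\<close>

definition vec_poly :: "nat \<Rightarrow> (nat \<Rightarrow> nat) \<Rightarrow> complex vec \<Rightarrow> complex poly" where
  "vec_poly k e v = (\<Sum>t\<in>{1..<k}. monom (v $ t) (e t))"

text \<open>The parametrisation by \<open>\<complex>\<^sup>2 \<oplus> \<hh>\<close>: the central part \<open>w\<close> gives the constants \<open>w\<^sub>0\<close> and the
multiples \<open>w\<^sub>1\<close> of \<open>x A - J\<close>, and \<open>E\<close> corresponds to \<open>-x \<partial>\<^sub>x - x A\<close>, with the sign that makes the
eigenvalues positive.\<close>

definition model_op :: "nat \<Rightarrow> (nat \<Rightarrow> real) \<Rightarrow> nat \<Rightarrow> (nat \<Rightarrow> nat) \<Rightarrow> complex vec \<times> complex vec \<Rightarrow> operator" where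
  "model_op N a k e = (\<lambda>(w, v). normal_op N a (w $ 1) (- v $ 0) ([:w $ 0:] + vec_poly k e v))"

lemma coeff_vec_poly: "coeff (vec_poly k e v) i = (\<Sum>t\<in>{1..<k}. if e t = i then v $ t else 0)"
  by (simp add: vec_poly_def coeff_sum coeff_monom)

lemma vec_poly_add:
  "u \<in> carrier_vec k \<Longrightarrow> v \<in> carrier_vec k \<Longrightarrow> vec_poly k e (u + v) = vec_poly k e u + vec_poly k e v"
  by (rule poly_eqI, unfold coeff_vec_poly coeff_add sum.distrib[symmetric], intro sum.cong) auto

lemma vec_poly_smult:
  "v \<in> carrier_vec k \<Longrightarrow> vec_poly k e (c \<cdot>\<^sub>v v) = Polynomial.smult c (vec_poly k e v)"
  by (rule poly_eqI, unfold coeff_vec_poly coeff_smult sum_distrib_left, intro sum.cong) auto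

lemma coeff_vec_poly_exponent:
  assumes "inj_on e {1..<k}" "t \<in> {1..<k}"
  shows "coeff (vec_poly k e v) (e t) = v $ t"
proof -
  have "coeff (vec_poly k e v) (e t) = (\<Sum>s\<in>{1..<k}. if t = s then v $ s else 0)"
    unfolding coeff_vec_poly using assms by (intro sum.cong) (auto dest: inj_onD)
  then show ?thesis using assms(2) by simp
qed

lemma coeff_vec_poly_outside: "i \<notin> e ` {1..<k} \<Longrightarrow> coeff (vec_poly k e v) i = 0"
  unfolding coeff_vec_poly by (intro sum.neutral) auto

text \<open>The operator \<open>x \<partial>\<^sub>x\<close> has \<open>x\<^sup>i\<close> as an eigenvector for the eigenvalue \<open>i\<close>.\<close>

lemma coeff_euler: "coeff (monom 1 1 * pderiv p) i = of_nat i * coeff (p :: complex poly) i"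
  by (cases i) (simp_all add: coeff_monom_mult coeff_pderiv)

text \<open>The exponents \<open>e t\<close> are distinct and positive. Hence the coefficients of \<open>w\<^sub>0 + \<Sum>\<^sub>t v\<^sub>t x\<^sup>e\<^sup>(\<^sup>t\<^sup>)\<close> give
back the coordinates, and \<open>model_op\<close> is injective.\<close>

lemma lie_isomorphic_g_phi:
  assumes "N \<ge> 2" and k: "k > 0" and inj: "inj_on e {1..<k}"
    and exps: "e ` {1..<k} = insert 1 {i. i \<ge> 2 \<and> coeff \<phi> i \<noteq> 0}"
  shows "lie_isomorphic (g_phi N \<nu> a \<phi>)
    (lie_direct_sum (abelian_lie 2) (diagonal_lie k (\<lambda>t. of_nat (e t))))"
proof -
  let ?h = "diagonal_lie k (\<lambda>t. of_nat (e t))"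
  let ?M = "lie_direct_sum (abelian_lie 2) ?h" and ?L = "diffop_lie N"
  let ?T = "model_op N a k e"
  have carrier_M: "carrier ?M = carrier_vec 2 \<times> carrier_vec k"
    by (simp add: lie_direct_sum_def abelian_lie_def)
  have zero_exp: "0 \<notin> e ` {1..<k}" unfolding exps by simp
  have hom: "?T \<in> module_hom class_ring ?M ?L"
    unfolding module_hom_def
  proof (intro CollectI conjI allI impI funcsetI)
    show "?T x \<in> carrier ?L" for x
      by (cases x) (simp add: model_op_def normal_op_carrier)
    fix x y assume xy: "x \<in> carrier ?M \<and> y \<in> carrier ?M"
    obtain w v w' v' where x: "x = (w, v)" and y: "y = (w', v')" by (cases x, cases y) auto
    have carr: "w \<in> carrier_vec 2" "w' \<in> carrier_vec 2" "v \<in> carrier_vec k" "v' \<in> carrier_vec k"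
      using xy by (auto simp: x y carrier_M)
    have sum: "(w, v) \<oplus>\<^bsub>?M\<^esub> (w', v') = (w + w', v + v')"
      by (simp add: lie_direct_sum_def abelian_lie_def)
    have "[:(w + w') $ 0:] + vec_poly k e (v + v')
        = ([:w $ 0:] + vec_poly k e v) + ([:w' $ 0:] + vec_poly k e v')"
      using carr by (simp add: vec_poly_add)
    then show "?T (x \<oplus>\<^bsub>?M\<^esub> y) = ?T x \<oplus>\<^bsub>?L\<^esub> ?T y"
      using carr k unfolding x y sum model_op_def prod.case normal_op_add by simp
  next
    fix c :: complex and x assume cx: "c \<in> carrier class_ring \<and> x \<in> carrier ?M"
    obtain w v where x: "x = (w, v)" by (cases x) auto
    have carr: "w \<in> carrier_vec 2" "v \<in> carrier_vec k"
      using cx by (auto simp: x carrier_M)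
    have prod: "c \<odot>\<^bsub>?M\<^esub> (w, v) = (c \<cdot>\<^sub>v w, c \<cdot>\<^sub>v v)"
      by (simp add: lie_direct_sum_def abelian_lie_def)
    have "[:(c \<cdot>\<^sub>v w) $ 0:] + vec_poly k e (c \<cdot>\<^sub>v v) = Polynomial.smult c ([:w $ 0:] + vec_poly k e v)"
      using carr by (simp add: vec_poly_smult smult_add_right)
    then show "?T (c \<odot>\<^bsub>?M\<^esub> x) = c \<odot>\<^bsub>?L\<^esub> ?T x"
      using carr k unfolding x prod model_op_def prod.case normal_op_smult by simp
  qed
  have inj_T: "inj_on ?T (carrier ?M)"
  proof (rule inj_onI)
    fix x y assume xy: "x \<in> carrier ?M" "y \<in> carrier ?M" "?T x = ?T y"
    obtain w v w' v' where x: "x = (w, v)" and y: "y = (w', v')" by (cases x, cases y) auto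
    have carr: "w \<in> carrier_vec 2" "w' \<in> carrier_vec 2" "v \<in> carrier_vec k" "v' \<in> carrier_vec k"
      using xy by (auto simp: x y carrier_M)
    have eq: "w $ 1 = w' $ 1" "v $ 0 = v' $ 0"
        "[:w $ 0:] + vec_poly k e v = [:w' $ 0:] + vec_poly k e v'"
      using normal_op_inject[OF assms(1) xy(3)[unfolded x y model_op_def prod.case]] by auto
    have coeffs: "coeff ([:w $ 0:] + vec_poly k e v) i = coeff ([:w' $ 0:] + vec_poly k e v') i" for i
      by (simp only: eq(3))
    have "w $ 0 = w' $ 0"
      using coeffs[of 0] by (simp add: coeff_vec_poly_outside[OF zero_exp])
    then have "w $ i = w' $ i" if "i < 2" for i
      using that eq(1) by (auto simp: less_2_cases_iff)
    moreover have "v $ t = v' $ t" if "t < k" for t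
    proof (cases "t = 0")
      case False
      then have t: "t \<in> {1..<k}" using that by auto
      then have "e t \<noteq> 0" using zero_exp by (metis imageI)
      then show ?thesis
        using coeffs[of "e t"] coeff_vec_poly_exponent[OF inj t] by (cases "e t") simp_all
    qed (use eq(2) in simp)
    ultimately show "x = y"
      using carr by (auto simp: x y intro!: eq_vecI)
  qed
  have bracket: "?T (lie_bracket ?M x y) = lie_bracket ?L (?T x) (?T y)"
    if xy: "x \<in> carrier ?M" "y \<in> carrier ?M" for x y
  proof -
    obtain w u w' v where x: "x = (w, u)" and y: "y = (w', v)" by (cases x, cases y) auto
    let ?p = "[:w $ 0:] + vec_poly k e u" and ?q = "[:w' $ 0:] + vec_poly k e v"
    have euler: "coeff (monom 1 1 * pderiv ([:c:] + r)) i = of_nat i * coeff r i"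
      for c :: complex and r i
      unfolding coeff_euler by (cases i) simp_all
    have poly_eq: "vec_poly k e (lie_bracket ?h u v)
        = monom 1 1 * (Polynomial.smult (- v $ 0) (pderiv ?p) - Polynomial.smult (- u $ 0) (pderiv ?q))"
    proof (rule poly_eqI)
      fix i
      have "coeff (vec_poly k e (lie_bracket ?h u v)) i
          = (\<Sum>t\<in>{1..<k}. of_nat i * (u $ 0 * (if e t = i then v $ t else 0)
              - v $ 0 * (if e t = i then u $ t else 0)))"
        unfolding coeff_vec_poly by (intro sum.cong) auto
      also have "\<dots> = of_nat i * (u $ 0 * coeff (vec_poly k e v) i - v $ 0 * coeff (vec_poly k e u) i)"
        by (simp only: coeff_vec_poly sum_distrib_left[symmetric] sum_subtractf)
      also have "\<dots> = - v $ 0 * coeff (monom 1 1 * pderiv ?p) i + u $ 0 * coeff (monom 1 1 * pderiv ?q) i"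
        unfolding euler by (simp add: algebra_simps)
      finally show "coeff (vec_poly k e (lie_bracket ?h u v)) i
        = coeff (monom 1 1 * (Polynomial.smult (- v $ 0) (pderiv ?p) - Polynomial.smult (- u $ 0) (pderiv ?q))) i"
        by (simp add: ring_distribs mult_smult_right del: pderiv_add)
    qed
    have pair: "lie_bracket ?M (w, u) (w', v) = (0\<^sub>v 2, lie_bracket ?h u v)"
      by (simp only: lie_direct_sum_def abelian_lie_def lie.simps module.simps fst_conv snd_conv)
    have zero: "lie_bracket ?h u v $ 0 = 0"
      using k by simp
    show ?thesis
      unfolding x y pair model_op_def prod.case bracket_normal_op poly_eq zero by simp
  qed
  have "?T ` carrier ?M = normal_ops N a \<phi>"
  proof (intro equalityI subsetI)
    fix E assume "E \<in> ?T ` carrier ?M"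
    then obtain w v where E: "E = normal_op N a (w $ 1) (- v $ 0) ([:w $ 0:] + vec_poly k e v)"
      by (auto simp: model_op_def)
    have "vec_poly k e v \<in> support_poly \<phi>"
      using coeff_vec_poly_outside[of _ e k v] unfolding exps support_poly_def by blast
    then have "[:w $ 0:] + vec_poly k e v \<in> support_poly \<phi>"
      using support_poly_linear[of "w $ 0" 0 \<phi>] by (simp add: support_poly_add)
    then show "E \<in> normal_ops N a \<phi>"
      unfolding E normal_ops_def by blast
  next
    fix E assume "E \<in> normal_ops N a \<phi>"
    then obtain c \<alpha> p where E: "E = normal_op N a c \<alpha> p" and p: "p \<in> support_poly \<phi>"
      by (auto simp: normal_ops_def)
    define w where "w = vec 2 (\<lambda>i. if i = 0 then coeff p 0 else c)"
    define v where "v = vec k (\<lambda>t. if t = 0 then - \<alpha> else coeff p (e t))"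
    have const_coeff: "coeff [:b:] i = 0" if "i \<noteq> 0" for b :: complex and i
      using that by (cases i) simp_all
    have "[:w $ 0:] + vec_poly k e v = p"
    proof (rule poly_eqI)
      fix i
      consider "i = 0" | t where "t \<in> {1..<k}" "i = e t" "i \<noteq> 0" | "i \<noteq> 0" "i \<notin> e ` {1..<k}"
        by blast
      then show "coeff ([:w $ 0:] + vec_poly k e v) i = coeff p i"
      proof cases
        case 1
        then show ?thesis by (simp add: coeff_vec_poly_outside[OF zero_exp] w_def)
      next
        case 2
        then show ?thesis
          using coeff_vec_poly_exponent[OF inj 2(1), of v] const_coeff[OF 2(3)] 2(1)
          unfolding 2(2) by (simp add: v_def)
      next
        case 3
        have "coeff p i = 0"
        proof (rule ccontr)
          assume "coeff p i \<noteq> 0"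
          then have "i = 0 \<or> i = 1 \<or> coeff \<phi> i \<noteq> 0"
            using p unfolding support_poly_def by blast
          moreover have "i \<noteq> 1" "\<not> (i \<ge> 2 \<and> coeff \<phi> i \<noteq> 0)"
            using 3(2) unfolding exps by simp_all
          ultimately show False using 3(1) by linarith
        qed
        then show ?thesis
          using const_coeff[OF 3(1)] coeff_vec_poly_outside[OF 3(2)] by simp
      qed
    qed
    then have "?T (w, v) = E"
      using k by (simp add: model_op_def E w_def v_def)
    moreover have "(w, v) \<in> carrier ?M"
      by (simp add: carrier_M w_def v_def)
    ultimately show "E \<in> ?T ` carrier ?M" by blast
  qed
  then have "g_phi N \<nu> a \<phi> = ?L\<lparr>carrier := ?T ` carrier ?M\<rparr>"
    using g_phi_carrier[of N \<nu> a \<phi>] by (simp add: g_phi_def)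
  moreover have "lie_algebra ?M"
    by (rule lie_algebra_direct_sum[OF lie_algebra_abelian lie_algebra_diagonal_lie[OF k]])
  ultimately show ?thesis
    using lie_isomorphic_image[OF vectorspace_diffop_lie _ hom inj_T bracket] by simp
qed

text \<open>The case distinction in the value of \<open>k\<close> compensates for the coefficients of \<open>1\<close> and \<open>x\<close>:
whether they vanish or not, \<open>1\<close> and \<open>x\<close> are among the generators.\<close>

lemma card_nonzero_coeffs:
  fixes \<phi> :: "complex poly"
  assumes "k = (if poly \<phi> 0 = 0 \<and> poly (pderiv \<phi>) 0 = 0 then card {i. coeff \<phi> i \<noteq> 0} + 2
              else if poly \<phi> 0 \<noteq> 0 \<and> poly (pderiv \<phi>) 0 \<noteq> 0 then card {i. coeff \<phi> i \<noteq> 0}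
              else card {i. coeff \<phi> i \<noteq> 0} + 1)"
  shows "k = card {i \<in> {2..degree \<phi>}. coeff \<phi> i \<noteq> 0} + 2"
proof -
  let ?I = "{i \<in> {2..degree \<phi>}. coeff \<phi> i \<noteq> 0}" and ?low = "{i. i < 2 \<and> coeff \<phi> i \<noteq> 0}"
  have "coeff \<phi> i \<noteq> 0 \<longleftrightarrow> i \<in> ?I \<union> ?low" for i
    using le_degree[of \<phi> i] by (cases "i < 2") auto
  then have "{i. coeff \<phi> i \<noteq> 0} = ?I \<union> ?low"
    by blast
  then have "card {i. coeff \<phi> i \<noteq> 0} = card (?I \<union> ?low)"
    by (rule arg_cong)
  also have "\<dots> = card ?I + card ?low"
    by (rule card_Un_disjoint) auto
  finally have split: "card {i. coeff \<phi> i \<noteq> 0} = card ?I + card ?low" .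
  have "i \<in> ?low \<longleftrightarrow> i \<in> (if coeff \<phi> 0 = 0 then {} else {0}) \<union> (if coeff \<phi> 1 = 0 then {} else {1})" for i
    by (cases "i = 0"; cases "i = 1") auto
  then have low: "?low = (if coeff \<phi> 0 = 0 then {} else {0}) \<union> (if coeff \<phi> 1 = 0 then {} else {1})"
    by blast
  have at_0: "poly \<phi> 0 = coeff \<phi> 0" "poly (pderiv \<phi>) 0 = coeff \<phi> 1"
    by (simp_all add: poly_0_coeff_0 coeff_pderiv)
  show ?thesis
    using assms unfolding split low at_0
    by (cases "coeff \<phi> 0 = 0"; cases "coeff \<phi> 1 = 0") simp_all
qed

theorem theorem4p8:
  fixes N n l k :: nat and \<nu> :: real and a :: "nat \<Rightarrow> real" and \<phi> :: "complex poly"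
  assumes "N \<ge> 2" and "\<nu> > 0"
    and "degree \<phi> = n" and "n \<ge> 2"
    and "l = card {i. coeff \<phi> i \<noteq> 0}"
    and "k = (if poly \<phi> 0 = 0 \<and> poly (pderiv \<phi>) 0 = 0 then l + 2
              else if poly \<phi> 0 \<noteq> 0 \<and> poly (pderiv \<phi>) 0 \<noteq> 0 then l
              else l + 1)"
  shows "\<exists>(j :: nat \<Rightarrow> nat) (h :: complex vec lie).
    strict_mono_on {1..k - 2} j \<and>
    j ` {1..k - 2} = {i \<in> {2..n}. coeff \<phi> i \<noteq> 0} \<and>
    lie_isomorphic (g_phi N \<nu> a \<phi>) (lie_direct_sum (abelian_lie 2) h) \<and>
    lie_algebra h \<and> lie_solvable h \<and> lie_has_dim h k \<and>
    (\<exists>R. is_nilradical R h \<and> lie_abelian (h\<lparr>carrier := R\<rparr>) \<and>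
         lie_has_dim (h\<lparr>carrier := R\<rparr>) (k - 1)) \<and>
    (\<exists>(E :: complex vec) (F :: nat \<Rightarrow> complex vec).
       vectorspace.basis (class_ring :: complex ring) h (insert E (F ` {1..k - 1})) \<and>
       lie_semidirect h (lie_span h {E}) (lie_span h (F ` {1..k - 1})) \<and>
       lie_abelian (h\<lparr>carrier := lie_span h (F ` {1..k - 1})\<rparr>) \<and>
       lie_bracket h E (F 1) = F 1 \<and>
       (\<forall>t \<in> {2..k - 1}. lie_bracket h E (F t) = complex_of_nat (j (t - 1)) \<odot>\<^bsub>h\<^esub> F t))"
proof -
  define I where "I = {i \<in> {2..n}. coeff \<phi> i \<noteq> 0}"
  define js where "js = sorted_list_of_set I"
  define j where "j t = js ! (t - 1)" for t
  \<comment> \<open>The exponents of the basis monomials: the generator \<open>x\<close> first, then the exponents from \<open>\<phi>\<close>.\<close>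
  define e where "e t = (1 # js) ! (t - 1)" for t
  define h where "h = diagonal_lie k (\<lambda>t. of_nat (e t))"
  let ?E = "unit_vec k 0 :: complex vec" and ?F = "unit_vec k :: nat \<Rightarrow> complex vec"
  have I: "finite I" "n \<in> I"
    using assms(3,4) by (auto simp: I_def)
  have js: "length js = card I" "set js = I" "sorted_wrt (<) js" "distinct js"
    using I by (auto simp: js_def)
  have k: "k = card I + 2"
    using card_nonzero_coeffs[of k \<phi>] assms(3,5,6) by (simp add: I_def)
  have "card I > 0" using I card_gt_0_iff by blast
  then have k3: "k \<ge> 3" using k by simp
  have j_mono: "strict_mono_on {1..k - 2} j"
    unfolding j_def
    by (intro strict_mono_onI sorted_wrt_nth_less[OF js(3)]) (auto simp: js(1) k)
  have j_image: "j ` {1..k - 2} = I"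
  proof -
    have "{1..k - 2} = Suc ` {0..<k - 2}"
      by (simp add: atLeastLessThanSuc_atLeastAtMost)
    moreover have "j ` Suc ` A = (!) js ` A" for A
      by (simp only: j_def image_image diff_Suc_1)
    ultimately have "j ` {1..k - 2} = (!) js ` {0..<k - 2}"
      by (simp only:)
    also have "\<dots> = I"
      using nth_image[of "k - 2" js] js(1,2) k by simp
    finally show ?thesis .
  qed
  have e_j: "e t = j (t - 1)" if "t \<ge> 2" for t
    using that by (simp add: e_def j_def nth_Cons')
  have e_1: "e 1 = 1" by (simp add: e_def)
  have set_split: "{1..<k} = insert 1 (Suc ` {1..k - 2})"
    using k3 by (auto simp: image_Suc_atLeastAtMost)
  have "e ` Suc ` {1..k - 2} = j ` {1..k - 2}"
    unfolding image_image by (rule image_cong) (simp_all add: e_j)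
  then have "e ` {1..<k} = insert 1 (j ` {1..k - 2})"
    unfolding set_split image_insert e_1 by simp
  moreover have I_eq: "I = {i. i \<ge> 2 \<and> coeff \<phi> i \<noteq> 0}"
    using le_degree[of \<phi>] assms(3) by (auto simp: I_def)
  ultimately have e_image: "e ` {1..<k} = insert 1 {i. i \<ge> 2 \<and> coeff \<phi> i \<noteq> 0}"
    using j_image by simp
  have e_inj: "inj_on e {1..<k}"
  proof (rule eq_card_imp_inj_on)
    have "1 \<notin> I" by (simp add: I_def)
    then show "card (e ` {1..<k}) = card {1..<k}"
      using I(1) k unfolding e_image I_eq[symmetric] by simp
  qed simp
  have iso: "lie_isomorphic (g_phi N \<nu> a \<phi>) (lie_direct_sum (abelian_lie 2) h)"
    unfolding h_def using lie_isomorphic_g_phi[OF assms(1) _ e_inj e_image] k3 by simp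
  have span: "lie_span h (?F ` {1..k - 1}) = zero_first k"
    unfolding h_def by (rule span_unit_vecs_pos) (use k3 in simp)
  have bracket: "lie_bracket h ?E (?F t) = of_nat (e t) \<cdot>\<^sub>v ?F t" if "t \<in> {1..k - 1}" for t
    using that k3 by (intro eq_vecI) (auto simp: h_def)
  have "insert ?E (?F ` {1..k - 1}) = ?F ` (insert 0 {1..k - 1})"
    by simp
  also have "insert 0 {1..k - 1} = {..<k}"
    using k3 by auto
  finally have basis: "vectorspace.basis (class_ring :: complex ring) h (insert ?E (?F ` {1..k - 1}))"
    by (simp add: h_def basis_unit_vecs)
  have nilradical: "is_nilradical (zero_first k) h"
    unfolding h_def by (rule is_nilradical_zero_first[of 1]) (use k3 e_1 in auto)
  have E_F: "vectorspace.basis (class_ring :: complex ring) h (insert ?E (?F ` {1..k - 1})) \<and>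
       lie_semidirect h (lie_span h {?E}) (lie_span h (?F ` {1..k - 1})) \<and>
       lie_abelian (h\<lparr>carrier := lie_span h (?F ` {1..k - 1})\<rparr>) \<and>
       lie_bracket h ?E (?F 1) = ?F 1 \<and>
       (\<forall>t \<in> {2..k - 1}. lie_bracket h ?E (?F t) = complex_of_nat (j (t - 1)) \<odot>\<^bsub>h\<^esub> ?F t)"
  proof (intro conjI ballI basis)
    show "lie_semidirect h (lie_span h {?E}) (lie_span h (?F ` {1..k - 1}))"
      unfolding span unfolding h_def by (rule lie_semidirect_diagonal_lie) (use k3 in simp)
    show "lie_abelian (h\<lparr>carrier := lie_span h (?F ` {1..k - 1})\<rparr>)"
      unfolding span unfolding h_def by (rule lie_abelian_zero_first)
    show "lie_bracket h ?E (?F 1) = ?F 1"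
      using bracket[of 1] k3 e_1 by simp
    show "lie_bracket h ?E (?F t) = complex_of_nat (j (t - 1)) \<odot>\<^bsub>h\<^esub> ?F t" if "t \<in> {2..k - 1}" for t
      using bracket[of t] that e_j[of t] by (simp add: h_def)
  qed
  have R: "is_nilradical (zero_first k) h \<and> lie_abelian (h\<lparr>carrier := zero_first k\<rparr>) \<and>
         lie_has_dim (h\<lparr>carrier := zero_first k\<rparr>) (k - 1)"
    using nilradical k3 lie_has_dim_zero_first[of k] lie_abelian_zero_first unfolding h_def by simp
  have h: "lie_algebra h" "lie_solvable h" "lie_has_dim h k"
    using k3 by (simp_all add: h_def lie_algebra_diagonal_lie lie_solvable_diagonal_lie lie_has_dim_diagonal_lie)
  show ?thesis
    using j_mono j_image[unfolded I_def] iso h R E_F by blast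
qed

end
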